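(* For every $p \in (0,1)$ there is $\varepsilon_p > 0$, with $\varepsilon_p \to 1$ as $p \to 1$, and there is a function $\delta_p(n)$ with $\delta_p(n)\to 0$ as $n\to\infty$, such that for every $n$ and $d$ there is an $\mathsf{AC}^0$ formula $F_{n,d}$ of size at most $n^{2-\varepsilon_p}$ satisfying $$\Pr_{x \sim \mathrm{OV}(p)_{n,d}}\big[F_{n,d}(x) \neq \mathrm{OV}_{n,d}(x)\big] \leq \delta_p(n).$$
   Context: The Orthogonal Vectors function $\mathrm{OV}_{n,d}:\{0,1\}^{nd}\to\{0,1\}$ takes $n$ vectors $v_1,\ldots,v_n \in \{0,1\}^d$ and outputs $1$ iff there exist $i,j$ with $\langle v_i,v_j\rangle = 0$. For $p\in(0,1)$, $\mathrm{OV}(p)_{n,d}$ denotes the distribution on $\{0,1\}^{nd}$ in which every one of the $nd$ bits is independently $1$ with probability $p$ and $0$ otherwise. An $\mathsf{AC}^0$ formula is a formula (tree) of constant depth (independent of $n,d$) with unbounded fan-in AND and OR gates and NOT gates; size is the number of nodes. *)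

theory Defs
  imports "HOL-Probability.Probability"
begin

text \<open>
  An input in \<open>{0,1}\<^sup>n\<^sup>d\<close> is a function \<open>x :: nat \<times> nat \<Rightarrow> bool\<close>, of which only the values on
  \<open>{..<n} \<times> {..<d}\<close> matter; \<open>x (i, k)\<close> is the \<open>k\<close>-th coordinate of the vector \<open>v\<^sub>i\<close>.
\<close>

definition bits :: "nat \<Rightarrow> nat \<Rightarrow> (nat \<times> nat) set" where
  "bits n d = {..<n} \<times> {..<d}"

definition inner_vec :: "nat \<Rightarrow> (nat \<times> nat \<Rightarrow> bool) \<Rightarrow> nat \<Rightarrow> nat \<Rightarrow> nat" where
  "inner_vec d x i j = (\<Sum>k<d. of_bool (x (i, k)) * of_bool (x (j, k)))"

text \<open>The indices \<open>i\<close> and \<open>j\<close> are not required to be distinct.\<close>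

definition OV :: "nat \<Rightarrow> nat \<Rightarrow> (nat \<times> nat \<Rightarrow> bool) \<Rightarrow> bool" where
  "OV n d x \<longleftrightarrow> (\<exists>i<n. \<exists>j<n. inner_vec d x i j = 0)"

text \<open>Positions outside \<open>bits n d\<close> are deterministically \<open>False\<close>.\<close>

definition OV_dist :: "real \<Rightarrow> nat \<Rightarrow> nat \<Rightarrow> (nat \<times> nat \<Rightarrow> bool) pmf" where
  "OV_dist p n d = Pi_pmf (bits n d) False (\<lambda>_. bernoulli_pmf p)"

text \<open>
  A gate may have any finite number of children, including none: \<open>And []\<close> and \<open>Or []\<close> are the
  constants true and false, each of size 1.
\<close>

datatype (vars: 'v) formula =
    Var 'v
  | Neg "'v formula"
  | And "'v formula list"
  | Or "'v formula list"

fun eval_formula :: "('v \<Rightarrow> bool) \<Rightarrow> 'v formula \<Rightarrow> bool" where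
  "eval_formula x (Var v) = x v"
| "eval_formula x (Neg F) = (\<not> eval_formula x F)"
| "eval_formula x (And Fs) = (\<forall>F\<in>set Fs. eval_formula x F)"
| "eval_formula x (Or Fs) = (\<exists>F\<in>set Fs. eval_formula x F)"

text \<open>The number of nodes of the tree; leaves and negations are counted.\<close>

fun formula_size :: "'v formula \<Rightarrow> nat" where
  "formula_size (Var v) = 1"
| "formula_size (Neg F) = 1 + formula_size F"
| "formula_size (And Fs) = 1 + (\<Sum>F\<leftarrow>Fs. formula_size F)"
| "formula_size (Or Fs) = 1 + (\<Sum>F\<leftarrow>Fs. formula_size F)"

text \<open>The length of a longest root-to-leaf path; negations are counted.\<close>

fun formula_depth :: "'v formula \<Rightarrow> nat" where
  "formula_depth (Var v) = 0"
| "formula_depth (Neg F) = 1 + formula_depth F"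
| "formula_depth (And Fs) = 1 + Max (insert 0 (formula_depth ` set Fs))"
| "formula_depth (Or Fs) = 1 + Max (insert 0 (formula_depth ` set Fs))"

end

theory Submission imports Defs "HOL-Real_Asymp.Real_Asymp" begin

text \<open>
  Two independent random vectors are orthogonal with probability \<open>q = (1 - p\<^sup>2)\<^sup>d\<close>, so the
  expected number of orthogonal pairs is about \<open>n\<^sup>2 q\<close>. If this number is polynomially small, the
  constant false works; if it is polynomially large, a second moment bound shows that the constant
  true works. Only \<open>d\<close> close to \<open>2 ln n / rate p\<close>, where \<open>rate p = - ln (1 - p\<^sup>2)\<close>, remain.

  There, a member of an orthogonal pair is atypically light: its bits are Bernoulli with parameter
  \<open>p / (1 + p)\<close> instead of \<open>p\<close>. A likelihood-ratio test on boundedly many blocks of \<open>\<tau> ln n\<close>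
  coordinates discards all but a polynomially small fraction of the vectors and keeps most
  orthogonal pairs. Split the indices into groups of size \<open>n powr \<tau>\<close> and replace each group by the
  disjunction of its light vectors. Testing all pairs of groups costs about \<open>n powr (2 - \<tau>)\<close> times
  the size of the light test, which is about \<open>2 powr (\<tau> ln n) = n powr (\<tau> ln 2)\<close>. A group disjunction
  dominates each of its light members, so the formula never errs by accepting, and it finds an
  orthogonal pair whenever both members are the only light vectors of their groups.

  When \<open>p\<close> is close to 1, the interesting \<open>d\<close> are so small that the exact formula of size about
  \<open>2 ^ d * n * d\<close>, ranging over all supports, is already good enough.
\<close>

section \<open>Rows of the input as independent vectors\<close>

lemma expectation_pair_pmf_finite:
  fixes f :: "'a \<times> 'b \<Rightarrow> real"
  assumes "finite (set_pmf M)" "finite (set_pmf N)"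
  shows "measure_pmf.expectation (pair_pmf M N) f =
    measure_pmf.expectation M (\<lambda>a. measure_pmf.expectation N (\<lambda>b. f (a, b)))"
proof -
  have "measure_pmf.expectation (pair_pmf M N) f
      = (\<Sum>z\<in>set_pmf M \<times> set_pmf N. pmf (pair_pmf M N) z * f z)"
    using assms by (subst integral_measure_pmf[of "set_pmf M \<times> set_pmf N"]) (auto simp: mult.commute)
  also have "\<dots> = (\<Sum>a\<in>set_pmf M. pmf M a * (\<Sum>b\<in>set_pmf N. pmf N b * f (a, b)))"
    by (simp add: sum_distrib_left sum.cartesian_product)
      (auto intro!: sum.cong simp: pmf_pair)
  also have "\<dots> = measure_pmf.expectation M (\<lambda>a. measure_pmf.expectation N (\<lambda>b. f (a, b)))"
    using assms by (simp add: integral_measure_pmf[where A = "set_pmf M"]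
      integral_measure_pmf[where A = "set_pmf N"])
  finally show ?thesis .
qed

lemma prob_eq_expectation:
  "measure_pmf.prob M A = measure_pmf.expectation M (\<lambda>x. indicator A x)"
  by simp

lemma prob_pair_pmf:
  "measure_pmf.prob (pair_pmf M N) {z. P (fst z) \<and> Q (snd z)} =
    measure_pmf.prob M {x. P x} * measure_pmf.prob N {y. Q y}"
  if "finite (set_pmf M)" "finite (set_pmf N)"
proof -
  have "measure_pmf.prob (pair_pmf M N) {z. P (fst z) \<and> Q (snd z)} =
     measure_pmf.expectation (pair_pmf M N) (\<lambda>z. indicator {x. P x} (fst z) * indicator {y. Q y} (snd z))"
    unfolding prob_eq_expectation
    by (intro Bochner_Integration.integral_cong) (auto simp: indicator_def)
  then show ?thesis
    using that by (simp add: expectation_pair_pmf_finite)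
qed

lemma finite_set_Pi_pmf:
  assumes "finite A" "\<And>x. x \<in> A \<Longrightarrow> finite (set_pmf (M x))"
  shows "finite (set_pmf (Pi_pmf A z M))"
  using assms by (auto simp: set_Pi_pmf intro: finite_PiE_dflt)

text \<open>The condition on \<open>g\<close> says that it ignores coordinate \<open>i\<close>,
  which makes \<open>v i\<close> and \<open>g v\<close> independent. Peeling off one coordinate at a
  time in this way yields the joint laws of two, three and four distinct rows.\<close>

lemma Pi_pmf_coordinate_pair:
  assumes I: "finite I" "i \<in> I" and g: "\<And>v x. g (v(i := x)) = g v"
  shows "map_pmf (\<lambda>v. (v i, g v)) (Pi_pmf I z M) = pair_pmf (M i) (map_pmf g (Pi_pmf I z M))"
proof -
  have P: "Pi_pmf I z M = map_pmf (\<lambda>(y, f). f(i := y)) (pair_pmf (M i) (Pi_pmf (I - {i}) z M))"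
    using I Pi_pmf_insert[of "I - {i}" i z M] by (simp add: insert_absorb)
  have "map_pmf g (Pi_pmf I z M) = map_pmf (g \<circ> snd) (pair_pmf (M i) (Pi_pmf (I - {i}) z M))"
    unfolding P by (simp add: map_pmf_comp case_prod_beta' g o_def)
  also have "\<dots> = map_pmf g (Pi_pmf (I - {i}) z M)"
    by (simp flip: map_pmf_comp add: o_def map_snd_pair_pmf)
  finally have gg: "map_pmf g (Pi_pmf I z M) = map_pmf g (Pi_pmf (I - {i}) z M)" .
  show ?thesis
    unfolding gg unfolding P
    by (simp add: map_pmf_comp case_prod_beta' g pair_map_pmf2 apsnd_def map_prod_def)
qed

lemma Pi_pmf_two_coordinates:
  assumes "finite I" "i \<in> I" "j \<in> I" "i \<noteq> j"
  shows "map_pmf (\<lambda>v. (v i, v j)) (Pi_pmf I z M) = pair_pmf (M i) (M j)"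
  using assms by (simp add: Pi_pmf_coordinate_pair Pi_pmf_component)

lemma Pi_pmf_three_coordinates:
  assumes "finite I" "i \<in> I" "j \<in> I" "k \<in> I" "i \<noteq> j" "i \<noteq> k" "j \<noteq> k"
  shows "map_pmf (\<lambda>v. (v i, v j, v k)) (Pi_pmf I z M) = pair_pmf (M i) (pair_pmf (M j) (M k))"
  using assms Pi_pmf_coordinate_pair[of I i "\<lambda>v. (v j, v k)" z M]
  by (simp add: Pi_pmf_two_coordinates)

lemma Pi_pmf_four_coordinates:
  assumes "finite I" "i \<in> I" "j \<in> I" "k \<in> I" "l \<in> I" "distinct [i, j, k, l]"
  shows "map_pmf (\<lambda>v. (v i, v j, v k, v l)) (Pi_pmf I z M) =
    pair_pmf (M i) (pair_pmf (M j) (pair_pmf (M k) (M l)))"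
  using assms by (subst Pi_pmf_coordinate_pair) (auto simp: Pi_pmf_three_coordinates)

section \<open>Orthogonality of independent random rows\<close>

definition orth :: "nat \<Rightarrow> (nat \<Rightarrow> bool) \<Rightarrow> (nat \<Rightarrow> bool) \<Rightarrow> bool" where
  "orth d u v \<longleftrightarrow> (\<forall>k<d. \<not> (u k \<and> v k))"

definition vec_pmf :: "real \<Rightarrow> nat \<Rightarrow> (nat \<Rightarrow> bool) pmf" where
  "vec_pmf p d = Pi_pmf {..<d} False (\<lambda>_. bernoulli_pmf p)"

text \<open>The default row is constantly false, so that after uncurrying the missing rows agree
  with the default \<open>False\<close> of \<open>OV_dist\<close>.\<close>

definition rows_pmf :: "real \<Rightarrow> nat \<Rightarrow> nat \<Rightarrow> (nat \<Rightarrow> nat \<Rightarrow> bool) pmf" where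
  "rows_pmf p n d = Pi_pmf {..<n} (\<lambda>_. False) (\<lambda>_. vec_pmf p d)"

lemma orth_commute: "orth d u v \<longleftrightarrow> orth d v u"
  by (auto simp: orth_def)

lemma finite_vec_pmf [simp]: "finite (set_pmf (vec_pmf p d))"
  unfolding vec_pmf_def by (rule finite_set_Pi_pmf) auto

lemma finite_rows_pmf [simp]: "finite (set_pmf (rows_pmf p n d))"
  unfolding rows_pmf_def by (rule finite_set_Pi_pmf) auto

lemma OV_case_prod: "OV n d (case_prod v) \<longleftrightarrow> (\<exists>i<n. \<exists>j<n. orth d (v i) (v j))"
  by (simp add: OV_def inner_vec_def orth_def) blast

text \<open>Uncurrying is injective, so point masses can be compared directly. At a function
  vanishing off \<open>bits n d\<close> both sides are the same product of bit probabilities; at any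
  other function both are 0.\<close>

lemma OV_dist_eq: "OV_dist p n d = map_pmf case_prod (rows_pmf p n d)"
proof (rule pmf_eqI)
  fix x :: "nat \<times> nat \<Rightarrow> bool"
  have inj: "inj (case_prod :: (nat \<Rightarrow> nat \<Rightarrow> bool) \<Rightarrow> _)"
    by (metis curry_case_prod injI)
  have "pmf (map_pmf case_prod (rows_pmf p n d)) x = pmf (rows_pmf p n d) (curry x)"
    using pmf_map_inj'[OF inj, of "rows_pmf p n d" "curry x"] by simp
  also have "\<dots> = pmf (OV_dist p n d) x"
  proof (cases "\<forall>z. z \<notin> bits n d \<longrightarrow> x z = False")
    case True
    then have 1: "\<forall>i. i \<notin> {..<n} \<longrightarrow> curry x i = (\<lambda>_. False)"
      and 2: "\<And>i. \<forall>k. k \<notin> {..<d} \<longrightarrow> curry x i k = False"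
      by (auto simp: bits_def fun_eq_iff)
    have "finite (bits n d)" by (simp add: bits_def)
    then show ?thesis
      using True 1 2 unfolding OV_dist_def rows_pmf_def vec_pmf_def
      by (simp add: pmf_Pi) (simp add: bits_def prod.cartesian_product)
  next
    case False
    then obtain i k where x: "x (i, k)" "\<not> (i < n \<and> k < d)" by (auto simp: bits_def)
    have "pmf (rows_pmf p n d) (curry x) = 0"
    proof (cases "i < n")
      case True
      with x have "pmf (vec_pmf p d) (curry x i) = 0"
        unfolding vec_pmf_def by (intro pmf_Pi_outside) auto
      with True show ?thesis unfolding rows_pmf_def by (auto simp: pmf_Pi)
    next
      case False
      with x show ?thesis unfolding rows_pmf_def
        by (intro pmf_Pi_outside) (auto simp: fun_eq_iff)
    qed
    moreover have "pmf (OV_dist p n d) x = 0"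
      unfolding OV_dist_def using x by (intro pmf_Pi_outside) (auto simp: bits_def)
    ultimately show ?thesis by simp
  qed
  finally show "pmf (OV_dist p n d) x = pmf (map_pmf case_prod (rows_pmf p n d)) x" by simp
qed

lemma prob_OV_dist:
  "measure_pmf.prob (OV_dist p n d) {x. P x} = measure_pmf.prob (rows_pmf p n d) {v. P (case_prod v)}"
  by (simp add: OV_dist_eq vimage_def)

lemma expectation_vec_pmf_prod:
  assumes "p \<in> {0..1}" "\<And>k b. \<phi> k b \<ge> 0"
  shows "measure_pmf.expectation (vec_pmf p d) (\<lambda>u. \<Prod>k<d. \<phi> k (u k)) =
    (\<Prod>k<d. p * \<phi> k True + (1 - p) * \<phi> k False)"
  unfolding vec_pmf_def using assms
  by (subst expectation_prod_Pi_pmf) (auto intro: integrable_measure_pmf_finite simp: algebra_simps)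

text \<open>The pairs of bits at distinct coordinates are independent, so the expectation splits
  into averages over the four bit patterns. Since \<open>\<phi>\<close> may depend on
  \<open>k\<close>, a test on one block of coordinates is covered as well.\<close>

lemma expectation_vec_pmf_pair_prod:
  assumes p: "p \<in> {0..1}" and \<phi>: "\<And>k a b. \<phi> k a b \<ge> 0"
  shows "measure_pmf.expectation (pair_pmf (vec_pmf p d) (vec_pmf p d)) (\<lambda>z. \<Prod>k<d. \<phi> k (fst z k) (snd z k)) =
    (\<Prod>k<d. p * (p * \<phi> k True True + (1 - p) * \<phi> k True False)
       + (1 - p) * (p * \<phi> k False True + (1 - p) * \<phi> k False False))"
proof -
  have "measure_pmf.expectation (vec_pmf p d)
      (\<lambda>u. \<Prod>k<d. (\<lambda>k a. p * \<phi> k a True + (1 - p) * \<phi> k a False) k (u k)) = (\<Prod>k<d. p * (p * \<phi> k True True + (1 - p) * \<phi> k True False)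
       + (1 - p) * (p * \<phi> k False True + (1 - p) * \<phi> k False False))"
    using p \<phi> by (subst expectation_vec_pmf_prod) auto
  moreover have "measure_pmf.expectation (vec_pmf p d) (\<lambda>v. \<Prod>k<d. \<phi> k (u k) (v k)) =
     (\<Prod>k<d. p * \<phi> k (u k) True + (1 - p) * \<phi> k (u k) False)" for u
    using p \<phi> by (subst expectation_vec_pmf_prod[where \<phi> = "\<lambda>k. \<phi> k (u k)"]) auto
  ultimately show ?thesis by (simp add: expectation_pair_pmf_finite)
qed

text \<open>Markov's inequality in the form used for all exponential-moment and second-moment
  bounds: \<open>f\<close> is a nonnegative majorant of the indicator of the event.\<close>

lemma prob_le_expectation:
  fixes f :: "'a \<Rightarrow> real"
  assumes "finite (set_pmf M)" "\<And>x. P x \<Longrightarrow> 1 \<le> f x" "\<And>x. 0 \<le> f x"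
  shows "measure_pmf.prob M {x. P x} \<le> measure_pmf.expectation M f"
proof -
  have "measure_pmf.prob M {x. P x} = measure_pmf.expectation M (indicator {x. P x})"
    by simp
  also have "\<dots> \<le> measure_pmf.expectation M f"
    using assms by (intro integral_mono integrable_measure_pmf_finite) (auto simp: indicator_def)
  finally show ?thesis .
qed

lemma prob_orth_pair:
  assumes "p \<in> {0..1}"
  shows "measure_pmf.prob (pair_pmf (vec_pmf p d) (vec_pmf p d)) {z. orth d (fst z) (snd z)} = (1 - p\<^sup>2) ^ d"
proof -
  have "measure_pmf.prob (pair_pmf (vec_pmf p d) (vec_pmf p d)) {z. orth d (fst z) (snd z)} =
    measure_pmf.expectation (pair_pmf (vec_pmf p d) (vec_pmf p d))
      (\<lambda>z. \<Prod>k<d. (\<lambda>k a b. of_bool (\<not> (a \<and> b))) k (fst z k) (snd z k))"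
    unfolding prob_eq_expectation
    by (intro Bochner_Integration.integral_cong) (auto simp: orth_def indicator_def prod_zero_iff)
  also have "\<dots> = (\<Prod>k<d. p * (1 - p) + (1 - p))"
    using assms by (subst expectation_vec_pmf_pair_prod) auto
  finally show ?thesis by (simp add: algebra_simps power2_eq_square)
qed

text \<open>A vector orthogonal to itself vanishes, which has probability
  \<open>(1 - p) ^ d\<close>. The weaker bound lets diagonal pairs share the estimate for pairs of
  distinct rows.\<close>

lemma prob_zero_vec:
  assumes "p \<in> {0..1}"
  shows "measure_pmf.prob (vec_pmf p d) {u. orth d u u} \<le> (1 - p\<^sup>2) ^ d"
proof -
  have "measure_pmf.prob (vec_pmf p d) {u. orth d u u} \<le>
     measure_pmf.expectation (vec_pmf p d) (\<lambda>u. \<Prod>k<d. (\<lambda>k b. of_bool (\<not> b)) k (u k))"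
    by (intro prob_le_expectation) (auto simp: orth_def prod_nonneg)
  also have "\<dots> = (1 - p) ^ d"
    using assms by (subst expectation_vec_pmf_prod) auto
  also have "\<dots> \<le> (1 - p\<^sup>2) ^ d"
    using assms by (intro power_mono) (auto simp: power2_eq_square mult_left_le)
  finally show ?thesis .
qed

lemma prob_rows_two:
  assumes "i < n" "j < n" "i \<noteq> j"
  shows "measure_pmf.prob (rows_pmf p n d) {v. P (v i) (v j)} =
    measure_pmf.prob (pair_pmf (vec_pmf p d) (vec_pmf p d)) {z. P (fst z) (snd z)}"
  unfolding rows_pmf_def using assms
  by (subst Pi_pmf_two_coordinates[of "{..<n}" i j "\<lambda>_. False" "\<lambda>_. vec_pmf p d", symmetric])
    (auto simp: vimage_def)

lemma prob_rows_orth_le: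
  assumes "p \<in> {0..1}" "i < n" "j < n"
  shows "measure_pmf.prob (rows_pmf p n d) {v. orth d (v i) (v j)} \<le> (1 - p\<^sup>2) ^ d"
proof (cases "i = j")
  case True
  have "measure_pmf.prob (rows_pmf p n d) {v. orth d (v i) (v i)} =
     measure_pmf.prob (map_pmf (\<lambda>v. v i) (rows_pmf p n d)) {u. orth d u u}"
    by (simp add: vimage_def)
  also have "\<dots> = measure_pmf.prob (vec_pmf p d) {u. orth d u u}"
    using assms unfolding rows_pmf_def by (subst Pi_pmf_component) auto
  finally show ?thesis using prob_zero_vec[OF assms(1), of d] True by simp
next
  case False
  then show ?thesis using assms by (simp add: prob_rows_two prob_orth_pair)
qed

section \<open>The light test\<close>

lemma prob_rows_OV_le:
  assumes "p \<in> {0..1}"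
  shows "measure_pmf.prob (rows_pmf p n d) {v. \<exists>i<n. \<exists>j<n. orth d (v i) (v j)} \<le> real n ^ 2 * (1 - p\<^sup>2) ^ d"
proof -
  have "{v. \<exists>i<n. \<exists>j<n. orth d (v i) (v j)} =
      (\<Union>z\<in>{..<n} \<times> {..<n}. {v. orth d (v (fst z)) (v (snd z))})" by fastforce
  then have "measure_pmf.prob (rows_pmf p n d) {v. \<exists>i<n. \<exists>j<n. orth d (v i) (v j)} \<le>
     (\<Sum>z\<in>{..<n} \<times> {..<n}. measure_pmf.prob (rows_pmf p n d) {v. orth d (v (fst z)) (v (snd z))})"
    by (simp only:) (intro measure_UNION_le, auto)
  also have "\<dots> \<le> (\<Sum>z\<in>{..<n} \<times> {..<n}. (1 - p\<^sup>2) ^ d)"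
    using assms by (intro sum_mono prob_rows_orth_le) auto
  finally show ?thesis by (simp add: power2_eq_square)
qed

text \<open>
  \<open>lr p b\<close> is the square root of the likelihood ratio, at a bit \<open>b\<close>, between the law of a member of an
  orthogonal pair and the unconditioned law; \<open>bhatt p\<close> is the Bhattacharyya coefficient of the two
  laws and bounds both error probabilities of the test \<open>light\<close>.
\<close>

definition lr :: "real \<Rightarrow> bool \<Rightarrow> real" where
  "lr p b = (if b then 1 / sqrt (1 + p) else 1 / sqrt (1 - p\<^sup>2))"

definition bhatt :: "real \<Rightarrow> real" where
  "bhatt p = (p + sqrt (1 - p)) / sqrt (1 + p)"

definition light :: "real \<Rightarrow> nat \<Rightarrow> nat \<Rightarrow> (nat \<Rightarrow> bool) \<Rightarrow> bool" where
  "light p l B u \<longleftrightarrow> (\<forall>b<B. 1 \<le> (\<Prod>k=b * l..<b * l + l. lr p (u k)))"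

lemma lr_pos: "0 < p \<Longrightarrow> p < 1 \<Longrightarrow> 0 < lr p b"
  by (auto simp: lr_def power2_eq_square mult_less_le_imp_less abs_square_less_1[unfolded power2_eq_square])
 
lemma bhatt_pos: "0 < p \<Longrightarrow> p < 1 \<Longrightarrow> 0 < bhatt p"
  by (auto simp: bhatt_def intro!: divide_pos_pos add_pos_pos)

text \<open>Strictness comes from \<open>2 * s < 1 + s\<^sup>2\<close> for
  \<open>s = sqrt (1 - p) \<noteq> 1\<close>. It is what makes the errors of the light test decay
  exponentially in the number of coordinates read.\<close>

lemma bhatt_less_1:
  assumes "0 < p" "p < 1"
  shows "bhatt p < 1"
proof -
  define s where "s = sqrt (1 - p)"
  have s: "s\<^sup>2 = 1 - p" "0 < s" "s \<noteq> 1" using assms by (auto simp: s_def)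
  have "0 < (1 - s)\<^sup>2" using s by simp
  then have *: "2 * s < 1 + s\<^sup>2" by (simp add: power2_diff)
  have "(p + s)\<^sup>2 = p * (p + 2 * s) + s\<^sup>2" by (simp add: power2_eq_square algebra_simps)
  also have "\<dots> < p * 2 + (1 - p)"
    using * s assms by (intro add_less_le_mono mult_strict_left_mono) auto
  finally have "p + s < sqrt (1 + p)"
    by (intro real_less_rsqrt) auto
  then show ?thesis using assms by (simp add: bhatt_def s_def)
qed

lemma sqrt_one_minus_square: "0 < p \<Longrightarrow> p < 1 \<Longrightarrow> sqrt (1 - p\<^sup>2) = sqrt (1 - p) * sqrt (1 + p)"
  by (simp flip: real_sqrt_mult add: algebra_simps power2_eq_square)

text \<open>For a light vector the product of \<open>lr\<close> is at least 1 on every block, hence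
  on all \<open>B * l\<close> coordinates together. The expectation of this product factors, and
  each bit contributes \<open>bhatt p\<close>. Passing all blocks thus gains the exponent
  \<open>B * l\<close>.\<close>

lemma prob_light_le:
  assumes p: "0 < p" "p < 1" and d: "B * l \<le> d"
  shows "measure_pmf.prob (vec_pmf p d) {u. light p l B u} \<le> bhatt p ^ (B * l)"
proof -
  define \<phi> where "\<phi> k b = (if k < B * l then lr p b else 1)" for k b
  have nn: "\<phi> k b \<ge> 0" for k b using lr_pos[OF p, of b] by (auto simp: \<phi>_def)
  have eq: "(\<Prod>k<d. \<phi> k (u k)) = (\<Prod>b<B. \<Prod>k=b * l..<b * l + l. lr p (u k))" for u
  proof -
    have "(\<Prod>k<d. \<phi> k (u k)) = (\<Prod>k<B * l. lr p (u k))"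
      using d by (intro prod.mono_neutral_cong_right) (auto simp: \<phi>_def)
    then show ?thesis by (simp add: prod.nat_group)
  qed
  have "measure_pmf.prob (vec_pmf p d) {u. light p l B u} \<le>
      measure_pmf.expectation (vec_pmf p d) (\<lambda>u. \<Prod>k<d. \<phi> k (u k))"
  proof (rule prob_le_expectation)
    show "1 \<le> (\<Prod>k<d. \<phi> k (u k))" if "light p l B u" for u
      unfolding eq by (rule prod_ge_1) (use that in \<open>auto simp only: light_def lessThan_iff\<close>)
  qed (auto intro: prod_nonneg nn)
  also have "\<dots> = (\<Prod>k<d. p * \<phi> k True + (1 - p) * \<phi> k False)"
    using p by (intro expectation_vec_pmf_prod nn) auto
  also have "\<dots> = (\<Prod>k<B * l. bhatt p)"
  proof (intro prod.mono_neutral_cong_right)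
    fix k assume "k \<in> {..<B * l}"
    have "(1 - p) / (sqrt (1 - p) * sqrt (1 + p)) = sqrt (1 - p) / sqrt (1 + p)"
      using p by (simp add: real_div_sqrt flip: divide_divide_eq_left)
    with \<open>k \<in> {..<B * l}\<close> show "p * \<phi> k True + (1 - p) * \<phi> k False = bhatt p"
      using p by (simp add: \<phi>_def lr_def sqrt_one_minus_square bhatt_def add_divide_distrib)
  qed (use d in \<open>auto simp: \<phi>_def\<close>)
  finally show ?thesis by simp
qed

text \<open>A vector failing the test has a product of \<open>lr\<close> below 1 on some block,
  where the reciprocal product exceeds 1. Only the length \<open>l\<close> of that one block is
  gained, and the union bound over the blocks costs the factor \<open>B\<close>.\<close>

lemma prob_orth_heavy_le:
  assumes p: "0 < p" "p < 1" and d: "B * l \<le> d"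
  shows "measure_pmf.prob (pair_pmf (vec_pmf p d) (vec_pmf p d)) {z. orth d (fst z) (snd z) \<and> \<not> light p l B (fst z)}
    \<le> real B * (bhatt p ^ l * (1 - p\<^sup>2) ^ d)"
proof -
  let ?M = "pair_pmf (vec_pmf p d) (vec_pmf p d)"
  have one: "measure_pmf.prob ?M {z. orth d (fst z) (snd z) \<and> (\<Prod>k=b * l..<b * l + l. lr p (fst z k)) < 1}
      \<le> bhatt p ^ l * (1 - p\<^sup>2) ^ d" if b: "b < B" for b
  proof -
    have "b * l + l \<le> B * l" using b by (metis Suc_leI add.commute mult_Suc mult_le_mono1)
    then have sub: "{b * l..<b * l + l} \<subseteq> {..<d}" using d by auto
    \<comment> \<open>The first factor encodes orthogonality on all coordinates; the tilt by
      \<open>1 / lr\<close> acts on the chosen block only.\<close>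
    define \<phi> where "\<phi> k x y = of_bool (\<not> (x \<and> y)) * (if k \<in> {b * l..<b * l + l} then 1 / lr p x else 1)"
      for k x y
    have nn: "\<phi> k x y \<ge> 0" for k x y using lr_pos[OF p, of x] by (auto simp: \<phi>_def)
    have "measure_pmf.prob ?M {z. orth d (fst z) (snd z) \<and> (\<Prod>k=b * l..<b * l + l. lr p (fst z k)) < 1}
      \<le> measure_pmf.expectation ?M (\<lambda>z. \<Prod>k<d. \<phi> k (fst z k) (snd z k))"
    proof (rule prob_le_expectation)
      fix z :: "(nat \<Rightarrow> bool) \<times> (nat \<Rightarrow> bool)"
      let ?P = "\<Prod>k=b * l..<b * l + l. lr p (fst z k)"
      assume z: "orth d (fst z) (snd z) \<and> ?P < 1"
      have pos: "?P > 0" by (intro prod_pos lr_pos ballI p)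
      have "(\<Prod>k<d. \<phi> k (fst z k) (snd z k)) = (\<Prod>k=b * l..<b * l + l. 1 / lr p (fst z k))"
        using z sub by (intro prod.mono_neutral_cong_right) (auto simp: \<phi>_def orth_def)
      also have "\<dots> = 1 / ?P" by (simp add: prod_dividef)
      finally show "1 \<le> (\<Prod>k<d. \<phi> k (fst z k) (snd z k))" using z pos by simp
    qed (auto intro: prod_nonneg nn)
    also have "\<dots> = (\<Prod>k<d. p * (p * \<phi> k True True + (1 - p) * \<phi> k True False)
       + (1 - p) * (p * \<phi> k False True + (1 - p) * \<phi> k False False))"
      using p by (intro expectation_vec_pmf_pair_prod nn) auto
    also have "\<dots> = (\<Prod>k<d. (1 - p\<^sup>2) * (if k \<in> {b * l..<b * l + l} then bhatt p else 1))"
    proof (rule prod.cong[OF refl])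
      fix k
      define s where "s = sqrt (1 - p)"
      define t where "t = sqrt (1 + p)"
      have st: "s\<^sup>2 = 1 - p" "t\<^sup>2 = 1 + p" "t > 0" using p by (auto simp: s_def t_def)
      \<comment> \<open>In this notation \<open>1 / lr p True\<close> is \<open>t\<close> and
        \<open>1 / lr p False\<close> is \<open>s * t\<close>; the sum runs over the three bit
        patterns that orthogonality allows.\<close>
      have "p * ((1 - p) * t) + (1 - p) * (p * (s * t) + (1 - p) * (s * t)) = (1 - p) * t * (p + s)"
        by algebra
      also have "\<dots> = (1 - p\<^sup>2) * (p + s) / t"
      proof -
        have "1 - p\<^sup>2 = (1 - p) * t\<^sup>2" using st by (simp add: algebra_simps power2_eq_square)
        then have "(1 - p) * t * (p + s) * t = (1 - p\<^sup>2) * (p + s)" by (simp add: power2_eq_square)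
        then show ?thesis using st by (simp add: eq_divide_eq)
      qed
      finally show "p * (p * \<phi> k True True + (1 - p) * \<phi> k True False)
       + (1 - p) * (p * \<phi> k False True + (1 - p) * \<phi> k False False) =
        (1 - p\<^sup>2) * (if k \<in> {b * l..<b * l + l} then bhatt p else 1)"
        using p by (auto simp: \<phi>_def lr_def sqrt_one_minus_square bhatt_def s_def t_def)
          (simp_all add: power2_eq_square algebra_simps)
    qed
    also have "\<dots> = (1 - p\<^sup>2) ^ d * (\<Prod>k<d. if k \<in> {b * l..<b * l + l} then bhatt p else 1)"
      by (simp add: prod.distrib)
    also have "(\<Prod>k<d. if k \<in> {b * l..<b * l + l} then bhatt p else 1) = (\<Prod>k=b * l..<b * l + l. bhatt p)"
      using sub by (intro prod.mono_neutral_cong_right) auto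
    finally show ?thesis by (simp add: mult.commute)
  qed
  have "{z. orth d (fst z) (snd z) \<and> \<not> light p l B (fst z)} =
     (\<Union>b<B. {z. orth d (fst z) (snd z) \<and> (\<Prod>k=b * l..<b * l + l. lr p (fst z k)) < 1})"
    by (auto simp: light_def not_le)
  then have "measure_pmf.prob ?M {z. orth d (fst z) (snd z) \<and> \<not> light p l B (fst z)} \<le>
     (\<Sum>b<B. measure_pmf.prob ?M {z. orth d (fst z) (snd z) \<and> (\<Prod>k=b * l..<b * l + l. lr p (fst z k)) < 1})"
    by (simp only:) (intro measure_UNION_le, auto)
  also have "\<dots> \<le> (\<Sum>b<B. bhatt p ^ l * (1 - p\<^sup>2) ^ d)" by (intro sum_mono one) auto
  finally show ?thesis by simp
qed

section \<open>Existence of orthogonal pairs\<close>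

lemma prob_as_iterated:
  assumes "finite (set_pmf M)" "finite (set_pmf N)"
  shows "measure_pmf.prob (pair_pmf M N) {z. P (fst z) (snd z)} =
    measure_pmf.expectation M (\<lambda>a. measure_pmf.prob N {b. P a b})"
  using assms by (subst prob_eq_expectation, subst expectation_pair_pmf_finite)
    (auto simp: prob_eq_expectation indicator_def simp del: Bochner_Integration.integral_indicator
      intro!: Bochner_Integration.integral_cong)

text \<open>
  Only pairs \<open>i < N \<le> j < 2 N\<close> are counted, so the two members of a counted pair never exchange roles.
\<close>

lemma second_moment_no_pair:
  fixes M :: "'a pmf" and R :: "'a \<Rightarrow> 'a \<Rightarrow> bool"
  assumes fin: "finite (set_pmf M)"
    and \<rho>: "\<rho> = measure_pmf.prob (pair_pmf M M) {z. R (fst z) (snd z)}" "\<rho> > 0"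
    and G: "\<And>u. measure_pmf.prob M {v. R u v} \<le> G" "\<And>v. measure_pmf.prob M {u. R u v} \<le> G"
    and N: "N > 0" "2 * N \<le> n"
  shows "measure_pmf.prob (Pi_pmf {..<n} z (\<lambda>_. M)) {v. \<forall>i<n. \<forall>j<n. \<not> R (v i) (v j)}
    \<le> 1 / (real N ^ 2 * \<rho>) + 2 * G / (real N * \<rho>)"
proof -
  let ?V = "Pi_pmf {..<n} z (\<lambda>_. M)"
  let ?E = "measure_pmf.expectation ?V"
  have finV: "finite (set_pmf ?V)" using fin by (intro finite_set_Pi_pmf) auto
  have int: "integrable (measure_pmf ?V) f" for f :: "_ \<Rightarrow> real"
    using finV by (rule integrable_measure_pmf_finite)
  have G0: "0 \<le> G" using G(1) measure_nonneg order_trans by blast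
  define S where "S = {..<N} \<times> {N..<2 * N}"
  have cardS: "card S = N * N" and finS: "finite S" by (simp_all add: S_def)
  define I :: "nat \<times> nat \<Rightarrow> (nat \<Rightarrow> 'a) \<Rightarrow> real"
    where "I s v = of_bool (R (v (fst s)) (v (snd s)))" for s v
  define X where "X v = (\<Sum>s\<in>S. I s v)" for v
  have swap: "measure_pmf.prob (pair_pmf M M) {z. R (snd z) (fst z)} = \<rho>"
    unfolding \<rho> by (subst (2) pair_commute_pmf) (simp add: vimage_def case_prod_beta')
  have prob_two: "measure_pmf.prob ?V {v. R (v i) (v j)} = \<rho>" if "i < n" "j < n" "i \<noteq> j" for i j
    unfolding \<rho> using that
    by (subst Pi_pmf_two_coordinates[of "{..<n}" i j z "\<lambda>_. M", symmetric]) (auto simp: vimage_def)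
  have EI: "?E (\<lambda>v. I s v) = \<rho>" if "s \<in> S" for s
  proof -
    have "?E (\<lambda>v. I s v) = measure_pmf.prob ?V {v. R (v (fst s)) (v (snd s))}"
      unfolding prob_eq_expectation by (intro Bochner_Integration.integral_cong) (auto simp: I_def indicator_def)
    also have "\<dots> = \<rho>" using that N by (intro prob_two) (auto simp: S_def)
    finally show ?thesis .
  qed
  have EX: "?E X = real N ^ 2 * \<rho>"
    unfolding X_def by (simp add: int EI cardS power2_eq_square)
  \<comment> \<open>Given the shared member, the two events are independent: one conditional
    probability is at most \<open>G\<close>, the other averages to \<open>\<rho>\<close>. Taking
    \<open>R\<close> or its transpose for \<open>Q\<close> treats a shared first or a shared second
    member.\<close>
  have triple: "measure_pmf.prob (pair_pmf M (pair_pmf M M)) {z. Q (fst z) (fst (snd z)) \<and> Q (fst z) (snd (snd z))}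
     \<le> \<rho> * G"
    if Q: "measure_pmf.prob (pair_pmf M M) {z. Q (fst z) (snd z)} = \<rho>"
      and GQ: "\<And>u. measure_pmf.prob M {v. Q u v} \<le> G" for Q
  proof -
    have "measure_pmf.prob (pair_pmf M (pair_pmf M M)) {z. Q (fst z) (fst (snd z)) \<and> Q (fst z) (snd (snd z))}
       = measure_pmf.expectation M (\<lambda>a. measure_pmf.prob (pair_pmf M M) {b. Q a (fst b) \<and> Q a (snd b)})"
      using fin by (subst prob_as_iterated[where P = "\<lambda>a b. Q a (fst b) \<and> Q a (snd b)"]) auto
    also have "\<dots> = measure_pmf.expectation M (\<lambda>a. measure_pmf.prob M {b. Q a b} * measure_pmf.prob M {b. Q a b})"
      using fin by (subst prob_pair_pmf) auto
    also have "\<dots> \<le> measure_pmf.expectation M (\<lambda>a. measure_pmf.prob M {b. Q a b} * G)"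
      using fin by (intro integral_mono integrable_measure_pmf_finite mult_left_mono GQ) auto
    also have "\<dots> = \<rho> * G" using fin by (simp add: prob_as_iterated flip: Q)
    finally show ?thesis .
  qed
  \<comment> \<open>Disjoint pairs are independent and give \<open>\<rho>\<^sup>2\<close>, pairs
    with one common index give at most \<open>\<rho> * G\<close>, and equal pairs give
    \<open>\<rho>\<close>. For \<open>s = t\<close> all three indicators fire, which only enlarges
    the bound.\<close>
  have EII: "?E (\<lambda>v. I s v * I t v) \<le> \<rho>\<^sup>2 + of_bool (fst s = fst t) * (\<rho> * G)
      + of_bool (snd s = snd t) * (\<rho> * G) + of_bool (s = t) * \<rho>" if st: "s \<in> S" "t \<in> S" for s t
  proof -
    obtain i j i' j' where s: "s = (i, j)" "t = (i', j')" by (cases s, cases t) auto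
    have ij: "i < n" "j < n" "i' < n" "j' < n" "i \<noteq> j" "i \<noteq> j'" "i' \<noteq> j" "i' \<noteq> j'"
      using st s N by (auto simp: S_def)
    have e: "?E (\<lambda>v. I s v * I t v) = measure_pmf.prob ?V {v. R (v i) (v j) \<and> R (v i') (v j')}"
      unfolding prob_eq_expectation by (intro Bochner_Integration.integral_cong) (auto simp: I_def s indicator_def)
    have nn: "0 \<le> \<rho>\<^sup>2" "0 \<le> \<rho> * G" using \<rho>(2) G0 by auto
    consider "i = i'" "j = j'" | "i = i'" "j \<noteq> j'" | "i \<noteq> i'" "j = j'" | "i \<noteq> i'" "j \<noteq> j'" by blast
    then show ?thesis
    proof cases
      case 1
      moreover have "0 \<le> \<rho>\<^sup>2 + \<rho> * G + \<rho> * G" using nn by (intro add_nonneg_nonneg)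
      ultimately show ?thesis using e prob_two[of i j] ij by (simp add: s)
    next
      case 2
      have "measure_pmf.prob ?V {v. R (v i) (v j) \<and> R (v i) (v j')} =
        measure_pmf.prob (map_pmf (\<lambda>v. (v i, v j, v j')) ?V)
          {z. R (fst z) (fst (snd z)) \<and> R (fst z) (snd (snd z))}"
        by (simp add: vimage_def)
      also have "\<dots> \<le> \<rho> * G"
        using 2 ij G triple[of R] \<rho>(1)[symmetric] by (subst Pi_pmf_three_coordinates) auto
      finally show ?thesis using e nn 2 by (simp add: s add_increasing)
    next
      case 3
      have "measure_pmf.prob ?V {v. R (v i) (v j) \<and> R (v i') (v j)} =
        measure_pmf.prob (map_pmf (\<lambda>v. (v j, v i, v i')) ?V)
          {z. R (fst (snd z)) (fst z) \<and> R (snd (snd z)) (fst z)}"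
        by (simp add: vimage_def)
      also have "\<dots> \<le> \<rho> * G"
        using 3 ij G triple[of "\<lambda>a b. R b a"] swap by (subst Pi_pmf_three_coordinates) auto
      finally show ?thesis using e nn 3 by (simp add: s add_increasing)
    next
      case 4
      have "measure_pmf.prob ?V {v. R (v i) (v j) \<and> R (v i') (v j')} =
        measure_pmf.prob (map_pmf (\<lambda>v. (v i, v j, v i', v j')) ?V)
          {z. R (fst z) (fst (snd z)) \<and> R (fst (snd (snd z))) (snd (snd (snd z)))}"
        by (simp add: vimage_def)
      also have "map_pmf (\<lambda>v. (v i, v j, v i', v j')) ?V = pair_pmf M (pair_pmf M (pair_pmf M M))"
        using 4 ij by (subst Pi_pmf_four_coordinates) auto
      also have "measure_pmf.prob (pair_pmf M (pair_pmf M (pair_pmf M M)))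
          {z. R (fst z) (fst (snd z)) \<and> R (fst (snd (snd z))) (snd (snd (snd z)))} =
        measure_pmf.expectation M (\<lambda>a. measure_pmf.prob (pair_pmf M (pair_pmf M M))
          {z. R a (fst z) \<and> R (fst (snd z)) (snd (snd z))})"
        using fin by (subst prob_as_iterated[where P = "\<lambda>a b. R a (fst b) \<and> R (fst (snd b)) (snd (snd b))"]) auto
      also have "\<dots> = measure_pmf.expectation M (\<lambda>a. measure_pmf.prob M {b. R a b} * \<rho>)"
        using fin \<rho> prob_pair_pmf[of M "pair_pmf M M" "R a" "\<lambda>b. R (fst b) (snd b)" for a] by simp
      also have "\<dots> = \<rho>\<^sup>2" using fin by (simp add: prob_as_iterated \<rho> power2_eq_square)
      finally show ?thesis using e nn 4 by (simp add: s)
    qed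
  qed
  have sums: "(\<Sum>s\<in>S. \<Sum>t\<in>S. of_bool (fst s = fst t)) = real N ^ 3"
     "(\<Sum>s\<in>S. \<Sum>t\<in>S. of_bool (snd s = snd t)) = real N ^ 3"
     "(\<Sum>s\<in>S. \<Sum>t\<in>S. of_bool (s = t)) = real N ^ 2"
  proof -
    have "(\<Sum>t\<in>S. of_bool (fst s = fst t)) = real N" if "s \<in> S" for s
    proof -
      have "S \<inter> {t. fst s = fst t} = {fst s} \<times> {N..<2 * N}" using that by (auto simp: S_def)
      then show ?thesis using finS by (simp add: of_bool_def sum.If_cases card_cartesian_product_singleton)
    qed
    then show "(\<Sum>s\<in>S. \<Sum>t\<in>S. of_bool (fst s = fst t)) = real N ^ 3"
      by (simp add: cardS power3_eq_cube)
    have "(\<Sum>t\<in>S. of_bool (snd s = snd t)) = real N" if "s \<in> S" for s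
    proof -
      have "S \<inter> {t. snd s = snd t} = {..<N} \<times> {snd s}" using that by (auto simp: S_def)
      then show ?thesis using finS by (simp add: of_bool_def sum.If_cases card_cartesian_product)
    qed
    then show "(\<Sum>s\<in>S. \<Sum>t\<in>S. of_bool (snd s = snd t)) = real N ^ 3"
      by (simp add: cardS power3_eq_cube)
    show "(\<Sum>s\<in>S. \<Sum>t\<in>S. of_bool (s = t)) = real N ^ 2"
      using finS by (simp add: of_bool_def cardS power2_eq_square)
  qed
  have "?E (\<lambda>v. (X v)\<^sup>2) = (\<Sum>s\<in>S. \<Sum>t\<in>S. ?E (\<lambda>v. I s v * I t v))"
    by (simp add: X_def power2_eq_square sum_product int)
  also have "\<dots> \<le> (\<Sum>s\<in>S. \<Sum>t\<in>S. \<rho>\<^sup>2 + of_bool (fst s = fst t) * (\<rho> * G)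
      + of_bool (snd s = snd t) * (\<rho> * G) + of_bool (s = t) * \<rho>)"
    by (intro sum_mono EII)
  also have "\<dots> = real N ^ 4 * \<rho>\<^sup>2 + real N ^ 3 * (\<rho> * G) + real N ^ 3 * (\<rho> * G) + real N ^ 2 * \<rho>"
    by (simp add: sum.distrib sums cardS flip: sum_distrib_right) (simp add: power4_eq_xxxx)
  finally have EX2: "?E (\<lambda>v. (X v)\<^sup>2) \<le> \<dots>" .
  define \<mu> where "\<mu> = real N ^ 2 * \<rho>"
  have \<mu>: "\<mu> > 0" using N \<rho> by (simp add: \<mu>_def)
  \<comment> \<open>Chebyshev's inequality: without a related pair \<open>X\<close> is 0 and
    deviates from its mean \<open>\<mu>\<close> by \<open>\<mu>\<close>.\<close>
  have "measure_pmf.prob ?V {v. \<forall>i<n. \<forall>j<n. \<not> R (v i) (v j)} \<le> ?E (\<lambda>v. (X v - \<mu>)\<^sup>2 / \<mu>\<^sup>2)"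
  proof (rule prob_le_expectation[OF finV])
    fix v assume "\<forall>i<n. \<forall>j<n. \<not> R (v i) (v j)"
    then have "X v = 0" using N unfolding X_def by (intro sum.neutral) (auto simp: I_def S_def)
    then show "1 \<le> (X v - \<mu>)\<^sup>2 / \<mu>\<^sup>2" using \<mu> by simp
  qed auto
  also have "\<dots> = (?E (\<lambda>v. (X v)\<^sup>2) - 2 * \<mu> * ?E X + \<mu>\<^sup>2) / \<mu>\<^sup>2"
    by (simp add: int power2_diff mult.assoc mult.left_commute)
  also have "\<dots> \<le> (real N ^ 4 * \<rho>\<^sup>2 + real N ^ 3 * (\<rho> * G) + real N ^ 3 * (\<rho> * G) + real N ^ 2 * \<rho>
      - 2 * \<mu> * ?E X + \<mu>\<^sup>2) / \<mu>\<^sup>2"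
    by (intro divide_right_mono add_mono diff_mono EX2) auto
  also have "\<dots> = (2 * real N ^ 3 * \<rho> * G + real N ^ 2 * \<rho>) / \<mu>\<^sup>2"
    unfolding EX \<mu>_def by (simp add: algebra_simps power2_eq_square power4_eq_xxxx)
  also have "\<dots> = 1 / (real N ^ 2 * \<rho>) + 2 * G / (real N * \<rho>)"
    using N \<rho>(2) by (simp add: \<mu>_def field_simps) (simp add: power_numeral_reduce)
  finally show ?thesis .
qed

section \<open>Hamming weight of members of orthogonal pairs\<close>

definition wt :: "nat \<Rightarrow> (nat \<Rightarrow> bool) \<Rightarrow> nat" where
  "wt d u = card {k \<in> {..<d}. u k}"

lemma expectation_wt:
  fixes h :: "nat \<Rightarrow> real"
  assumes p: "p \<in> {0..1}"
  shows "measure_pmf.expectation (vec_pmf p d) (\<lambda>u. h (wt d u)) =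
    (\<Sum>k\<le>d. real (d choose k) * p ^ k * (1 - p) ^ (d - k) * h k)"
proof -
  have "measure_pmf.expectation (vec_pmf p d) (\<lambda>u. h (wt d u)) =
     measure_pmf.expectation (binomial_pmf d p) h"
    using p unfolding vec_pmf_def wt_def
    by (subst binomial_pmf_altdef'[of "{..<d}" d p False]) auto
  also have "\<dots> = (\<Sum>k\<le>d. real (d choose k) * p ^ k * (1 - p) ^ (d - k) * h k)"
    using p by (subst integral_measure_pmf[where A = "{..d}"]) (auto simp: set_pmf_binomial_eq split: if_splits)
  finally show ?thesis .
qed

text \<open>Orthogonality to \<open>u\<close> forces \<open>v\<close> to vanish on the support of
  \<open>u\<close> and leaves its other bits free.\<close>

lemma prob_orth_fixed:
  assumes p: "p \<in> {0..1}"
  shows "measure_pmf.prob (vec_pmf p d) {v. orth d u v} = (1 - p) ^ wt d u"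
proof -
  have "measure_pmf.prob (vec_pmf p d) {v. orth d u v} =
     measure_pmf.expectation (vec_pmf p d) (\<lambda>v. \<Prod>k<d. (\<lambda>k b. of_bool (\<not> (u k \<and> b))) k (v k))"
    unfolding prob_eq_expectation
    by (intro Bochner_Integration.integral_cong) (auto simp: orth_def indicator_def prod_zero_iff)
  also have "\<dots> = (\<Prod>k<d. p * of_bool (\<not> (u k \<and> True)) + (1 - p) * of_bool (\<not> (u k \<and> False)))"
    using p by (intro expectation_vec_pmf_prod) auto
  also have "\<dots> = (\<Prod>k<d. if u k then 1 - p else 1)"
    by (intro prod.cong) auto
  also have "\<dots> = (1 - p) ^ wt d u"
    by (simp add: prod.If_cases wt_def Int_def)
  finally show ?thesis .
qed

text \<open>Conditioned on orthogonality, the weight of \<open>u\<close> is binomial with parameter \<open>p / (1 + p)\<close>.\<close>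

lemma prob_orth_wt:
  assumes p: "0 < p" "p < 1"
  shows "measure_pmf.prob (pair_pmf (vec_pmf p d) (vec_pmf p d)) {z. orth d (fst z) (snd z) \<and> wt d (fst z) \<in> W} =
    (1 - p\<^sup>2) ^ d * measure_pmf.prob (binomial_pmf d (p / (1 + p))) W"
proof -
  have p': "p / (1 + p) \<in> {0..1}" using p by auto
  have "measure_pmf.prob (pair_pmf (vec_pmf p d) (vec_pmf p d)) {z. orth d (fst z) (snd z) \<and> wt d (fst z) \<in> W}
     = measure_pmf.expectation (vec_pmf p d)
         (\<lambda>u. measure_pmf.prob (vec_pmf p d) {v. orth d u v \<and> wt d u \<in> W})"
    by (rule prob_as_iterated[where P = "\<lambda>u v. orth d u v \<and> wt d u \<in> W"]) auto
  also have "\<dots> = measure_pmf.expectation (vec_pmf p d) (\<lambda>u. indicator W (wt d u) * (1 - p) ^ wt d u)"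
    using p by (intro Bochner_Integration.integral_cong) (auto simp: indicator_def prob_orth_fixed)
  also have "\<dots> = (\<Sum>k\<le>d. real (d choose k) * p ^ k * (1 - p) ^ (d - k) * (indicator W k * (1 - p) ^ k))"
    using p by (subst expectation_wt[where h = "\<lambda>k. indicator W k * (1 - p) ^ k"]) auto
  also have "\<dots> = (\<Sum>k\<le>d. (1 - p\<^sup>2) ^ d * (real (d choose k) * (p / (1 + p)) ^ k * (1 - p / (1 + p)) ^ (d - k) * indicator W k))"
  proof (rule sum.cong[OF refl])
    fix k assume "k \<in> {..d}"
    then have d: "d = k + (d - k)" by simp
    have e: "1 - p / (1 + p) = 1 / (1 + p)" "1 - p\<^sup>2 = (1 - p) * (1 + p)"
      using p by (auto simp: field_simps power2_eq_square)
    have pq: "(1 + p) ^ d = (1 + p) ^ k * (1 + p) ^ (d - k)"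
      using d by (simp flip: power_add)
    \<comment> \<open>A true bit of \<open>u\<close> carries weight \<open>p * (1 - p)\<close> and a
      false one \<open>1 - p\<close>; dividing by \<open>1 - p\<^sup>2\<close> normalizes them to
      \<open>p / (1 + p)\<close> and \<open>1 / (1 + p)\<close>.\<close>
    have "(1 - p\<^sup>2) ^ d * ((p / (1 + p)) ^ k * (1 / (1 + p)) ^ (d - k)) = (1 - p) ^ d * p ^ k"
      unfolding e power_mult_distrib power_divide using p pq by (simp add: field_simps)
    also have "\<dots> = p ^ k * (1 - p) ^ (d - k) * (1 - p) ^ k"
      by (subst d) (simp add: power_add)
    finally show "real (d choose k) * p ^ k * (1 - p) ^ (d - k) * (indicator W k * (1 - p) ^ k) =
      (1 - p\<^sup>2) ^ d * (real (d choose k) * (p / (1 + p)) ^ k * (1 - p / (1 + p)) ^ (d - k) * indicator W k)"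
      unfolding e(1) by (simp add: ac_simps)
  qed
  also have "\<dots> = (1 - p\<^sup>2) ^ d * measure_pmf.expectation (binomial_pmf d (p / (1 + p))) (indicator W)"
  proof -
    have "measure_pmf.expectation (binomial_pmf d (p / (1 + p))) (indicator W) =
      (\<Sum>k\<le>d. pmf (binomial_pmf d (p / (1 + p))) k *\<^sub>R (indicator W k :: real))"
      using p' by (intro integral_measure_pmf) (auto simp: set_pmf_binomial_eq split: if_splits)
    also have "\<dots> = (\<Sum>k\<le>d. real (d choose k) * (p / (1 + p)) ^ k * (1 - p / (1 + p)) ^ (d - k) * indicator W k)"
      using p' by (intro sum.cong) auto
    finally show ?thesis by (simp only: sum_distrib_left)
  qed
  finally show ?thesis by simp
qed

lemma prob_orth_swap:
  "measure_pmf.prob (pair_pmf (vec_pmf p d) (vec_pmf p d)) {z. orth d (fst z) (snd z) \<and> P (snd z)} =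
   measure_pmf.prob (pair_pmf (vec_pmf p d) (vec_pmf p d)) {z. orth d (fst z) (snd z) \<and> P (fst z)}"
  by (subst pair_commute_pmf) (simp add: vimage_def case_prod_beta' orth_commute)

text \<open>The second moment bound with the trivial choice \<open>G = 1\<close>. It is good enough
  when \<open>d\<close> is bounded, because \<open>(1 - p\<^sup>2) ^ d\<close> is then bounded
  below.\<close>

lemma no_orth_small_dim:
  assumes p: "0 < p" "p < 1" and N: "N > 0" "2 * N \<le> n"
  shows "measure_pmf.prob (rows_pmf p n d) {v. \<forall>i<n. \<forall>j<n. \<not> orth d (v i) (v j)} \<le>
    3 / (real N * (1 - p\<^sup>2) ^ d)"
proof -
  let ?q = "(1 - p\<^sup>2) ^ d"
  have q: "?q > 0" using p by (simp add: power_less_one_iff abs_square_less_1)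
  have "measure_pmf.prob (rows_pmf p n d) {v. \<forall>i<n. \<forall>j<n. \<not> orth d (v i) (v j)} \<le>
     1 / (real N ^ 2 * ?q) + 2 * 1 / (real N * ?q)"
    unfolding rows_pmf_def using p N q
    by (intro second_moment_no_pair) (auto simp: prob_orth_pair)
  also have "1 / (real N ^ 2 * ?q) \<le> 1 / (real N * ?q)"
    using N q by (intro divide_left_mono mult_right_mono mult_pos_pos) (auto simp: power2_eq_square)
  finally show ?thesis by (simp add: add_divide_distrib)
qed

text \<open>
  The variance of the number of all orthogonal pairs is dominated by very light vectors. Counting
  only pairs of vectors in \<open>A\<close>, whose weight is typical for a member of an orthogonal pair, makes
  the conditional probability \<open>(1 - p) ^ wt d u\<close> constant up to the factor \<open>\<kappa>\<close>.
\<close>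

lemma no_orth_large_dim:
  assumes p: "0 < p" "p < 1" and N: "N > 0" "2 * N \<le> n" and \<eta>: "\<eta> > 0"
    and d: "ln 8 \<le> 2 * \<eta>\<^sup>2 * real d" "d > 0"
    and Y: "1 \<le> real N * sqrt ((1 - p\<^sup>2) ^ d)"
  shows "measure_pmf.prob (rows_pmf p n d) {v. \<forall>i<n. \<forall>j<n. \<not> orth d (v i) (v j)} \<le>
    8 * (1 - p) powr (- 2 * \<eta> * real d) / (real N * sqrt ((1 - p\<^sup>2) ^ d))"
proof -
  define q where "q = (1 - p\<^sup>2) ^ d"
  define p' where "p' = p / (1 + p)"
  let ?M = "vec_pmf p d"
  have p': "0 < p'" "p' < 1" using p by (auto simp: p'_def)
  have q: "q > 0" using p by (simp add: q_def power_less_one_iff abs_square_less_1)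
  define A where "A = {u. \<bar>real (wt d u) - real d * p'\<bar> < \<eta> * real d}"
  define R where "R u v \<longleftrightarrow> orth d u v \<and> u \<in> A \<and> v \<in> A" for u v
  define \<rho> where "\<rho> = measure_pmf.prob (pair_pmf ?M ?M) {z. R (fst z) (snd z)}"
  \<comment> \<open>Hoeffding's inequality for the binomial weight; the assumption on
    \<open>ln 8\<close> makes the two tails together at most 2/8.\<close>
  have atyp: "measure_pmf.prob (pair_pmf ?M ?M) {z. orth d (fst z) (snd z) \<and> fst z \<notin> A} \<le> q / 4"
  proof -
    interpret bd: binomial_distribution d p' using p' by unfold_locales auto
    let ?W = "{x. \<bar>real x - real d * p'\<bar> \<ge> \<eta> * real d}"
    have "measure_pmf.prob (pair_pmf ?M ?M) {z. orth d (fst z) (snd z) \<and> fst z \<notin> A} =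
      q * measure_pmf.prob (binomial_pmf d p') ?W"
      using prob_orth_wt[OF p, of d ?W] by (simp add: A_def q_def p'_def not_less)
    also have "measure_pmf.prob (binomial_pmf d p') ?W \<le> 2 * exp (- 2 * (\<eta> * real d)\<^sup>2 / real d)"
      using \<eta> d by (intro bd.prob_abs_ge) auto
    also have "- 2 * (\<eta> * real d)\<^sup>2 / real d = - (2 * \<eta>\<^sup>2 * real d)"
      using d by (simp add: power2_eq_square)
    also have "2 * exp (- (2 * \<eta>\<^sup>2 * real d)) \<le> 2 * exp (- ln 8)" using d by simp
    also have "\<dots> = 1 / 4" by (simp add: exp_minus)
    finally show ?thesis using q by simp
  qed
  have \<rho>_ge: "q / 2 \<le> \<rho>"
  proof -
    have "q = measure_pmf.prob (pair_pmf ?M ?M) {z. orth d (fst z) (snd z)}"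
      using p by (simp add: q_def prob_orth_pair)
    also have "{z. orth d (fst z) (snd z)} = {z. R (fst z) (snd z)} \<union>
        ({z. orth d (fst z) (snd z) \<and> fst z \<notin> A} \<union> {z. orth d (fst z) (snd z) \<and> snd z \<notin> A})"
      by (auto simp: R_def)
    also have "measure_pmf.prob (pair_pmf ?M ?M) \<dots> \<le> \<rho> + (q / 4 + q / 4)"
      unfolding \<rho>_def using atyp prob_orth_swap[of p d "\<lambda>u. u \<notin> A"]
      by (intro order_trans[OF measure_Un_le] add_mono order_refl) auto
    finally show ?thesis by simp
  qed
  \<comment> \<open>On \<open>A\<close> the value \<open>(1 - p) ^ wt d u\<close> lies between
    \<open>g\<close> and \<open>g * \<kappa>\<close>, by the two extreme weights that
    \<open>A\<close> admits.\<close>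
  define g where "g = (1 - p) powr (real d * p' + \<eta> * real d)"
  define \<kappa> where "\<kappa> = (1 - p) powr (- 2 * \<eta> * real d)"
  have g: "g > 0" using p by (simp add: g_def)
  have \<kappa>: "\<kappa> \<ge> 1" using p \<eta> powr_mono'[of "- 2 * \<eta> * real d" 0 "1 - p"] by (simp add: \<kappa>_def)
  have low: "g \<le> (1 - p) ^ wt d u" if "u \<in> A" for u
    using that p unfolding g_def A_def
    by (subst powr_realpow[symmetric]) (auto intro!: powr_mono')
  have up: "(1 - p) ^ wt d u \<le> g * \<kappa>" if "u \<in> A" for u
    using that p unfolding g_def A_def \<kappa>_def
    by (subst powr_realpow[symmetric], simp, subst powr_add[symmetric]) (auto intro!: powr_mono')
  define a where "a = measure_pmf.prob ?M A"
  \<comment> \<open>This and \<open>\<rho> \<le> a\<^sup>2\<close> eliminate the unknown probability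
    \<open>a\<close> of \<open>A\<close>: since \<open>\<rho>\<close> is at least
    \<open>q / 2\<close>, \<open>g\<close> is at most of the order of \<open>sqrt q\<close>.\<close>
  have "g * a \<le> q"
  proof -
    have "g * a = measure_pmf.expectation ?M (\<lambda>u. indicator A u * g)" by (simp add: a_def)
    also have "\<dots> \<le> measure_pmf.expectation ?M (\<lambda>u. measure_pmf.prob ?M {v. orth d u v})"
      using low p by (intro integral_mono integrable_measure_pmf_finite) (auto simp: indicator_def prob_orth_fixed)
    also have "\<dots> = q" using p by (subst prob_as_iterated[symmetric]) (auto simp: prob_orth_pair q_def)
    finally show ?thesis .
  qed
  moreover have "\<rho> \<le> a\<^sup>2"
  proof -
    have "\<rho> \<le> measure_pmf.prob (pair_pmf ?M ?M) {z. fst z \<in> A \<and> snd z \<in> A}"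
      unfolding \<rho>_def by (intro measure_pmf.finite_measure_mono) (auto simp: R_def)
    also have "\<dots> = a\<^sup>2" by (subst prob_pair_pmf) (auto simp: a_def power2_eq_square)
    finally show ?thesis .
  qed
  then have "sqrt \<rho> \<le> a" by (intro real_le_lsqrt) (auto simp: a_def)
  ultimately have g_le: "g * sqrt \<rho> \<le> q" using g by (meson mult_left_mono less_imp_le order_trans)
  have "measure_pmf.prob (rows_pmf p n d) {v. \<forall>i<n. \<forall>j<n. \<not> orth d (v i) (v j)} \<le>
    measure_pmf.prob (rows_pmf p n d) {v. \<forall>i<n. \<forall>j<n. \<not> R (v i) (v j)}"
    by (intro measure_pmf.finite_measure_mono) (auto simp: R_def)
  also have "\<dots> \<le> 1 / (real N ^ 2 * \<rho>) + 2 * (g * \<kappa>) / (real N * \<rho>)"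
    unfolding rows_pmf_def
  proof (rule second_moment_no_pair)
    show "0 < \<rho>" using \<rho>_ge q by simp
    have *: "measure_pmf.prob ?M {v. R u v} \<le> g * \<kappa>" for u
    proof (cases "u \<in> A")
      case True
      have "measure_pmf.prob ?M {v. R u v} \<le> measure_pmf.prob ?M {v. orth d u v}"
        by (intro measure_pmf.finite_measure_mono) (auto simp: R_def)
      also have "\<dots> \<le> g * \<kappa>" using up[OF True] p by (simp add: prob_orth_fixed)
      finally show ?thesis .
    qed (use g \<kappa> in \<open>simp add: R_def\<close>)
    show "measure_pmf.prob ?M {v. R u v} \<le> g * \<kappa>" for u by (rule *)
    have "{u. R u v} = {u. R v u}" for v by (auto simp: R_def orth_commute)
    with * show "measure_pmf.prob ?M {u. R u v} \<le> g * \<kappa>" for v by simp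
  qed (use N in \<open>auto simp: \<rho>_def\<close>)
  \<comment> \<open>With \<open>\<rho> \<ge> q / 2\<close> the left side is at most 2 over the
    square of \<open>real N * sqrt q\<close>; assumption \<open>Y\<close> allows one of the two
    factors to be dropped.\<close>
  also have "1 / (real N ^ 2 * \<rho>) \<le> 2 * \<kappa> / (real N * sqrt q)"
  proof -
    have "1 \<le> real N * sqrt q" using Y by (simp add: q_def)
    then have "1 \<le> 2 * \<kappa> * (real N * sqrt q) / 2" using \<kappa> mult_mono[of 1 \<kappa> 1 "real N * sqrt q"] by simp
    then have "1 * (real N * sqrt q) \<le> 2 * \<kappa> * (real N * sqrt q) / 2 * (real N * sqrt q)"
      using q by (intro mult_right_mono) auto
    also have "\<dots> = 2 * \<kappa> * (real N ^ 2 * (q / 2))" using q by (simp add: power2_eq_square)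
    also have "\<dots> \<le> 2 * \<kappa> * (real N ^ 2 * \<rho>)" using \<kappa> \<rho>_ge by (intro mult_left_mono) auto
    finally show ?thesis using N q \<rho>_ge by (simp add: divide_simps)
  qed
  also have "2 * (g * \<kappa>) / (real N * \<rho>) \<le> 6 * \<kappa> / (real N * sqrt q)"
  proof -
    have r: "\<rho> > 0" using \<rho>_ge q by simp
    have s: "sqrt q \<le> sqrt 2 * sqrt \<rho>" using \<rho>_ge by (simp flip: real_sqrt_mult)
    have "sqrt 2 \<le> 3/2" by (rule real_le_lsqrt) (auto simp: power2_eq_square)
    with r s have s: "sqrt q \<le> 3/2 * sqrt \<rho>" by (meson mult_right_mono order_trans real_sqrt_ge_zero less_imp_le)
    have "g * sqrt q \<le> g * (3/2 * sqrt \<rho>)" using s g by simp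
    also have "\<dots> \<le> 3/2 * q" using g_le by simp
    also have "\<dots> \<le> 3 * \<rho>" using \<rho>_ge by simp
    finally have "\<kappa> * (g * sqrt q) \<le> \<kappa> * (3 * \<rho>)" using \<kappa> by simp
    then show ?thesis using N q r by (simp add: divide_simps ac_simps)
  qed
  finally show ?thesis by (simp add: \<kappa>_def q_def add_divide_distrib[symmetric])
qed

section \<open>Isolated light vectors\<close>

text \<open>Groups are runs of \<open>m\<close> consecutive indices, numbered by
  \<open>i div m\<close>. If \<open>i\<close> is isolated, the disjunction of the light vectors of
  its group is \<open>v i\<close> itself.\<close>

definition isolated :: "real \<Rightarrow> nat \<Rightarrow> nat \<Rightarrow> nat \<Rightarrow> nat \<Rightarrow> (nat \<Rightarrow> nat \<Rightarrow> bool) \<Rightarrow> nat \<Rightarrow> bool" where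
  "isolated p l B n m v i \<longleftrightarrow>
     light p l B (v i) \<and> (\<forall>k<n. k div m = i div m \<longrightarrow> light p l B (v k) \<longrightarrow> k = i)"

lemma card_same_group:
  assumes "m > 0"
  shows "card {k. k < n \<and> k div m = c} \<le> m"
proof -
  have "{k. k < n \<and> k div m = c} \<subseteq> {c * m..<c * m + m}"
    using assms by (auto simp: div_mult_mod_eq less_mult_imp_div_less)
      (metis add.commute dividend_less_times_div mult.commute)
  from card_mono[OF _ this] show ?thesis by simp
qed

text \<open>Isolation fails if row \<open>i\<close> is heavy or if another row \<open>k\<close> of
  its group is light. As \<open>j\<close> lies in a different group, \<open>k\<close> differs from
  both \<open>i\<close> and \<open>j\<close>, so lightness of row \<open>k\<close> is independent of
  the orthogonality of rows \<open>i\<close> and \<open>j\<close>.\<close>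

lemma prob_not_isolated_le:
  assumes p: "0 < p" "p < 1" and d: "B * l \<le> d" and m: "m > 0"
    and ij: "i < n" "j < n" "i div m \<noteq> j div m"
  shows "measure_pmf.prob (rows_pmf p n d) {v. orth d (v i) (v j) \<and> \<not> isolated p l B n m v i} \<le>
    (1 - p\<^sup>2) ^ d * (real B * bhatt p ^ l + real m * bhatt p ^ (B * l))"
proof -
  let ?V = "rows_pmf p n d" and ?M = "vec_pmf p d"
  let ?K = "{k. k < n \<and> k div m = i div m} - {i}"
  have ne: "i \<noteq> j" using ij by auto
  have "{v. orth d (v i) (v j) \<and> \<not> isolated p l B n m v i} \<subseteq>
      {v. orth d (v i) (v j) \<and> \<not> light p l B (v i)} \<union>
      (\<Union>k\<in>?K. {v. orth d (v i) (v j) \<and> light p l B (v k)})"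
    by (auto simp: isolated_def)
  then have "measure_pmf.prob ?V {v. orth d (v i) (v j) \<and> \<not> isolated p l B n m v i} \<le>
      measure_pmf.prob ?V ({v. orth d (v i) (v j) \<and> \<not> light p l B (v i)} \<union>
        (\<Union>k\<in>?K. {v. orth d (v i) (v j) \<and> light p l B (v k)}))"
    by (intro measure_pmf.finite_measure_mono) auto
  also have "\<dots> \<le> measure_pmf.prob ?V {v. orth d (v i) (v j) \<and> \<not> light p l B (v i)} +
      (\<Sum>k\<in>?K. measure_pmf.prob ?V {v. orth d (v i) (v j) \<and> light p l B (v k)})"
    by (intro order_trans[OF measure_Un_le] add_mono order_refl measure_UNION_le) auto
  also have "\<dots> \<le> real B * (bhatt p ^ l * (1 - p\<^sup>2) ^ d) + (\<Sum>k\<in>?K. (1 - p\<^sup>2) ^ d * bhatt p ^ (B * l))"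
  proof (intro add_mono sum_mono)
    show "measure_pmf.prob ?V {v. orth d (v i) (v j) \<and> \<not> light p l B (v i)} \<le>
        real B * (bhatt p ^ l * (1 - p\<^sup>2) ^ d)"
      using prob_rows_two[of i n j p d "\<lambda>u w. orth d u w \<and> \<not> light p l B u"] ij ne
        prob_orth_heavy_le[OF p d] by simp
    fix k assume k: "k \<in> ?K"
    then have k: "k < n" "k \<noteq> i" "k \<noteq> j" using ij by auto
    have "measure_pmf.prob ?V {v. orth d (v i) (v j) \<and> light p l B (v k)} =
      measure_pmf.prob (map_pmf (\<lambda>v. (v k, v i, v j)) ?V)
        {z. light p l B (fst z) \<and> orth d (fst (snd z)) (snd (snd z))}"
      by (simp add: vimage_def conj_commute)
    also have "\<dots> = measure_pmf.prob ?M {u. light p l B u} *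
        measure_pmf.prob (pair_pmf ?M ?M) {z. orth d (fst z) (snd z)}"
      unfolding rows_pmf_def using k ij ne
      by (subst Pi_pmf_three_coordinates)
         (auto simp: prob_pair_pmf[where Q = "\<lambda>b. orth d (fst b) (snd b)"])
    also have "\<dots> \<le> bhatt p ^ (B * l) * (1 - p\<^sup>2) ^ d"
      using p by (subst prob_orth_pair) (auto intro!: mult_right_mono prob_light_le d simp: abs_square_le_1)
    finally show "measure_pmf.prob ?V {v. orth d (v i) (v j) \<and> light p l B (v k)} \<le>
      (1 - p\<^sup>2) ^ d * bhatt p ^ (B * l)" by (simp add: mult.commute)
  qed
  also have "\<dots> \<le> real B * (bhatt p ^ l * (1 - p\<^sup>2) ^ d) + real m * ((1 - p\<^sup>2) ^ d * bhatt p ^ (B * l))"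
  proof -
    have "card ?K \<le> m" using card_same_group[OF m, of n "i div m"] by (meson card_Diff1_le order_trans)
    then show ?thesis using p bhatt_pos[OF p]
      by (auto intro!: mult_right_mono mult_nonneg_nonneg simp: abs_square_le_1)
  qed
  finally show ?thesis by (simp add: algebra_simps)
qed

text \<open>Union bound over all orthogonal pairs that are not isolated on both sides. The at most
  \<open>n * m\<close> pairs inside one group are charged their full probability of being
  orthogonal; every other pair pays the isolation error once for each member.\<close>

lemma prob_no_isolated_pair_le:
  assumes p: "0 < p" "p < 1" and d: "B * l \<le> d" and m: "m > 0"
  shows "measure_pmf.prob (rows_pmf p n d) {v. (\<exists>i<n. \<exists>j<n. orth d (v i) (v j)) \<and>
      \<not> (\<exists>i<n. \<exists>j<n. orth d (v i) (v j) \<and> isolated p l B n m v i \<and> isolated p l B n m v j)} \<le>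
    (1 - p\<^sup>2) ^ d * (real n * real m + 2 * real n ^ 2 * (real B * bhatt p ^ l + real m * bhatt p ^ (B * l)))"
proof -
  let ?V = "rows_pmf p n d"
  define bad where "bad z = {v. orth d (v (fst z)) (v (snd z)) \<and>
    \<not> (isolated p l B n m v (fst z) \<and> isolated p l B n m v (snd z))}" for z
  define q where "q = (1 - p\<^sup>2) ^ d"
  define e where "e = real B * bhatt p ^ l + real m * bhatt p ^ (B * l)"
  define S where "S = {..<n} \<times> {..<n}"
  have q: "0 \<le> q" and e: "0 \<le> e"
    using p bhatt_pos[OF p] by (auto simp: q_def e_def abs_square_le_1)
  have bad: "measure_pmf.prob ?V (bad z) \<le> of_bool (fst z div m = snd z div m) * q + 2 * (q * e)"
    if z: "z \<in> S" for z
  proof (cases "fst z div m = snd z div m")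
    case True
    have "measure_pmf.prob ?V (bad z) \<le> measure_pmf.prob ?V {v. orth d (v (fst z)) (v (snd z))}"
      by (intro measure_pmf.finite_measure_mono) (auto simp: bad_def)
    also have "\<dots> \<le> q" unfolding q_def using p z by (intro prob_rows_orth_le) (auto simp: S_def)
    also have "q \<le> q + 2 * (q * e)" using q e by simp
    finally show ?thesis using True by simp
  next
    case False
    obtain i j where [simp]: "z = (i, j)" by (cases z)
    have ij: "i < n" "j < n" "i div m \<noteq> j div m" using z False by (auto simp: S_def)
    have "measure_pmf.prob ?V (bad z) \<le>
       measure_pmf.prob ?V ({v. orth d (v i) (v j) \<and> \<not> isolated p l B n m v i} \<union>
         {v. orth d (v j) (v i) \<and> \<not> isolated p l B n m v j})"
      by (intro measure_pmf.finite_measure_mono) (auto simp: bad_def orth_commute)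
    also have "\<dots> \<le> q * e + q * e"
      unfolding q_def e_def using ij p d m
      by (intro order_trans[OF measure_Un_le] add_mono prob_not_isolated_le) auto
    finally show ?thesis using False by (simp add: mult.commute)
  qed
  have "{v. (\<exists>i<n. \<exists>j<n. orth d (v i) (v j)) \<and>
      \<not> (\<exists>i<n. \<exists>j<n. orth d (v i) (v j) \<and> isolated p l B n m v i \<and> isolated p l B n m v j)} \<subseteq> (\<Union>z\<in>S. bad z)"
    by (fastforce simp: bad_def S_def)
  then have "measure_pmf.prob ?V {v. (\<exists>i<n. \<exists>j<n. orth d (v i) (v j)) \<and>
      \<not> (\<exists>i<n. \<exists>j<n. orth d (v i) (v j) \<and> isolated p l B n m v i \<and> isolated p l B n m v j)}
      \<le> measure_pmf.prob ?V (\<Union>z\<in>S. bad z)"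
    by (intro measure_pmf.finite_measure_mono) auto
  also have "\<dots> \<le> (\<Sum>z\<in>S. measure_pmf.prob ?V (bad z))"
    by (intro measure_UNION_le) (auto simp: S_def)
  also have "\<dots> \<le> (\<Sum>z\<in>S. of_bool (fst z div m = snd z div m) * q + 2 * (q * e))"
    by (intro sum_mono bad)
  also have "\<dots> = (\<Sum>z\<in>S. of_bool (fst z div m = snd z div m)) * q + real n ^ 2 * (2 * (q * e))"
    by (simp add: sum.distrib sum_distrib_right S_def power2_eq_square)
  also have "(\<Sum>z\<in>S. of_bool (fst z div m = snd z div m) :: real) =
      (\<Sum>i<n. real (card {j. j < n \<and> j div m = i div m}))"
    by (auto simp: S_def sum.cartesian_product' of_bool_def sum.If_cases Int_def intro!: sum.cong arg_cong[where f = card])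
  also have "\<dots> \<le> (\<Sum>i<n. real m)"
    using card_same_group[OF m] by (intro sum_mono) auto
  finally show ?thesis using q
    by (simp add: q_def[symmetric] e_def[symmetric] algebra_simps mult_right_mono)
qed

section \<open>Formulas\<close>

lemma sum_list_map_le:
  fixes f :: "'a \<Rightarrow> nat"
  assumes "\<And>x. x \<in> set xs \<Longrightarrow> f x \<le> c"
  shows "(\<Sum>x\<leftarrow>xs. f x) \<le> length xs * c"
  using assms by (induction xs) (auto intro!: add_mono)

lemma formula_size_And_map_le:
  assumes "\<And>x. x \<in> set xs \<Longrightarrow> formula_size (f x) \<le> c"
  shows "formula_size (And (map f xs)) \<le> 1 + length xs * c"
  using sum_list_map_le[of xs "\<lambda>x. formula_size (f x)" c] assms by (simp add: o_def)

lemma formula_size_Or_map_le: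
  assumes "\<And>x. x \<in> set xs \<Longrightarrow> formula_size (f x) \<le> c"
  shows "formula_size (Or (map f xs)) \<le> 1 + length xs * c"
  using sum_list_map_le[of xs "\<lambda>x. formula_size (f x)" c] assms by (simp add: o_def)

lemma formula_depth_And_le:
  assumes "\<And>F. F \<in> set Fs \<Longrightarrow> formula_depth F \<le> D"
  shows "formula_depth (And Fs) \<le> Suc D"
  using assms by auto

lemma formula_depth_Or_le:
  assumes "\<And>F. F \<in> set Fs \<Longrightarrow> formula_depth F \<le> D"
  shows "formula_depth (Or Fs) \<le> Suc D"
  using assms by auto

section \<open>Disjunctive normal forms and the light test as a formula\<close>

text \<open>The full disjunctive normal form of a Boolean function, given as a predicate
  \<open>h\<close> on the set of true positions. Each accepted subset contributes one conjunction,
  and \<open>f\<close> turns positions into variables.\<close>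

definition dnf :: "('a \<Rightarrow> 'v) \<Rightarrow> 'a list \<Rightarrow> ('a set \<Rightarrow> bool) \<Rightarrow> 'v formula" where
  "dnf f ks h = Or (map (\<lambda>S. And (map (\<lambda>k. if k \<in> set S then Var (f k) else Neg (Var (f k))) ks))
     (filter (\<lambda>S. h (set S)) (List.subseqs ks)))"

lemma eval_dnf: "eval_formula x (dnf f ks h) \<longleftrightarrow> h {k \<in> set ks. x (f k)}"
proof -
  have "eval_formula x (dnf f ks h) \<longleftrightarrow>
     (\<exists>S\<in>set ` set (List.subseqs ks). h S \<and> (\<forall>k\<in>set ks. x (f k) \<longleftrightarrow> k \<in> S))"
    by (auto simp: dnf_def simp del: if_image_distrib in_set_subseqs split: if_splits)
  also have "\<dots> \<longleftrightarrow> (\<exists>S\<subseteq>set ks. h S \<and> S = {k \<in> set ks. x (f k)})"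
    unfolding subseqs_powset by blast
  finally show ?thesis by auto
qed

lemma vars_dnf: "vars (dnf f ks h) \<subseteq> f ` set ks"
  by (auto simp: dnf_def split: if_splits)

lemma depth_dnf: "formula_depth (dnf f ks h) \<le> 3"
  unfolding dnf_def numeral_3_eq_3
  by (intro formula_depth_Or_le, clarsimp simp del: formula_depth.simps)
    (intro formula_depth_And_le, auto)

lemma size_dnf: "formula_size (dnf f ks h) \<le> 1 + 2 ^ length ks * (1 + 2 * length ks)"
proof -
  let ?xs = "filter (\<lambda>S. h (set S)) (List.subseqs ks)"
  have "formula_size (dnf f ks h) \<le> 1 + length ?xs * (1 + length ks * 2)"
    unfolding dnf_def by (intro formula_size_Or_map_le formula_size_And_map_le) auto
  also have "\<dots> \<le> 1 + 2 ^ length ks * (1 + length ks * 2)"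
    using length_filter_le[of _ "List.subseqs ks"]
    by (intro add_left_mono mult_right_mono) (simp_all add: length_subseqs)
  finally show ?thesis by (simp add: mult.commute)
qed

text \<open>Each block has its own normal form, so the exponential cost is \<open>2 ^ l\<close> and
  not \<open>2 ^ (B * l)\<close>. This is why \<open>light\<close> tests the blocks
  separately.\<close>

definition light_formula :: "real \<Rightarrow> nat \<Rightarrow> nat \<Rightarrow> nat \<Rightarrow> (nat \<times> nat) formula" where
  "light_formula p l B i = And (map (\<lambda>b. dnf (Pair i) [b * l..<b * l + l]
     (\<lambda>S. 1 \<le> (\<Prod>k=b * l..<b * l + l. lr p (k \<in> S)))) [0..<B])"

lemma eval_light_formula: "eval_formula (case_prod v) (light_formula p l B i) \<longleftrightarrow> light p l B (v i)"
proof -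
  have "(\<Prod>k=a..<b. lr p (k \<in> {k \<in> {a..<b}. v i k})) = (\<Prod>k=a..<b. lr p (v i k))" for a b
    by (intro prod.cong) auto
  then show ?thesis by (auto simp: light_formula_def light_def eval_dnf)
qed

lemma vars_light_formula:
  assumes "B * l \<le> d" "i < n"
  shows "vars (light_formula p l B i) \<subseteq> bits n d"
proof -
  have "b * l + l \<le> d" if "b < B" for b
    using assms(1) that by (metis Suc_leI add.commute mult_Suc mult_le_mono1 order_trans)
  then have "Pair i ` set [b * l..<b * l + l] \<subseteq> bits n d" if "b < B" for b
    using assms(2) that by (fastforce simp: bits_def)
  then have "vars (dnf (Pair i) [b * l..<b * l + l] h) \<subseteq> bits n d" if "b < B" for b h
    using vars_dnf that by (metis order_trans)
  then show ?thesis by (simp add: light_formula_def UN_subset_iff)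
qed

lemma depth_light_formula: "formula_depth (light_formula p l B i) \<le> 4"
  unfolding light_formula_def eval_nat_numeral
  by (intro formula_depth_And_le) (use depth_dnf in \<open>auto simp: eval_nat_numeral\<close>)

lemma size_light_formula: "formula_size (light_formula p l B i) \<le> 1 + B * (1 + 2 ^ l * (1 + 2 * l))"
proof -
  have "formula_size (dnf (Pair i) [b * l..<b * l + l] h) \<le> 1 + 2 ^ l * (1 + 2 * l)" for b h
    using size_dnf[of "Pair i" "[b * l..<b * l + l]" h] by simp
  then have "formula_size (light_formula p l B i) \<le> 1 + length [0..<B] * (1 + 2 ^ l * (1 + 2 * l))"
    unfolding light_formula_def by (intro formula_size_And_map_le) simp
  then show ?thesis by simp
qed

section \<open>Testing pairs of index groups\<close>

definition index_group :: "nat \<Rightarrow> nat \<Rightarrow> nat \<Rightarrow> nat list" where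
  "index_group n m g = filter (\<lambda>i. i div m = g) [0..<n]"

lemma set_index_group [simp]: "i \<in> set (index_group n m g) \<longleftrightarrow> i < n \<and> i div m = g"
  by (auto simp: index_group_def)

lemma length_index_group:
  assumes "m > 0"
  shows "length (index_group n m g) \<le> m"
proof -
  have "length (index_group n m g) = card (set (index_group n m g))"
    by (subst distinct_card) (auto simp: index_group_def)
  also have "set (index_group n m g) = {k. k < n \<and> k div m = g}" by auto
  finally show ?thesis using card_same_group[OF assms] by simp
qed

text \<open>\<open>L i\<close> is meant to select row \<open>i\<close>. A group without selected
  rows would behave like the zero vector, which is orthogonal to everything; this guard excludes
  it.\<close>

definition some_formula :: "(nat \<Rightarrow> (nat \<times> nat) formula) \<Rightarrow> nat list \<Rightarrow> (nat \<times> nat) formula" where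
  "some_formula L g = Or (map L g)"

text \<open>Coordinate \<open>k\<close> of the group vector, the disjunction of the selected rows of
  \<open>g\<close>.\<close>

definition bit_formula :: "(nat \<Rightarrow> (nat \<times> nat) formula) \<Rightarrow> nat list \<Rightarrow> nat \<Rightarrow> (nat \<times> nat) formula" where
  "bit_formula L g k = Or (map (\<lambda>i. And [L i, Var (i, k)]) g)"

definition pair_formula ::
  "(nat \<Rightarrow> (nat \<times> nat) formula) \<Rightarrow> nat \<Rightarrow> nat list \<Rightarrow> nat list \<Rightarrow> (nat \<times> nat) formula" where
  "pair_formula L d g h = And [some_formula L g, some_formula L h,
     And (map (\<lambda>k. Neg (And [bit_formula L g k, bit_formula L h k])) [0..<d])]"

text \<open>Group numbers run up to \<open>n div m\<close> inclusive because the last group may be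
  incomplete. If it is empty, the guard \<open>some_formula\<close> rejects it.\<close>

definition grouped_formula ::
  "(nat \<Rightarrow> (nat \<times> nat) formula) \<Rightarrow> nat \<Rightarrow> nat \<Rightarrow> nat \<Rightarrow> (nat \<times> nat) formula" where
  "grouped_formula L n d m = Or (map (\<lambda>(g, h). pair_formula L d (index_group n m g) (index_group n m h))
     (List.product [0..<Suc (n div m)] [0..<Suc (n div m)]))"

lemma vars_grouped_formula:
  assumes "\<And>i. i < n \<Longrightarrow> vars (L i) \<subseteq> bits n d"
  shows "vars (grouped_formula L n d m) \<subseteq> bits n d"
proof -
  have some: "vars (some_formula L (index_group n m g)) \<subseteq> bits n d" for g
    using assms by (simp add: some_formula_def UN_subset_iff)
  have "vars (bit_formula L (index_group n m g) k) \<subseteq> bits n d" if "k < d" for g k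
    using assms that by (simp add: bit_formula_def UN_subset_iff) (simp add: bits_def)
  then have "vars (pair_formula L d (index_group n m g) (index_group n m h)) \<subseteq> bits n d" for g h
    using some[of g] some[of h] unfolding pair_formula_def by (simp add: UN_subset_iff)
  then show ?thesis by (simp add: grouped_formula_def UN_subset_iff split_beta del: upt_Suc)
qed

lemma depth_grouped_formula:
  assumes "\<And>i. formula_depth (L i) \<le> D"
  shows "formula_depth (grouped_formula L n d m) \<le> D + 7"
proof -
  have some: "formula_depth (some_formula L g) \<le> Suc D" for g
    unfolding some_formula_def using assms by (intro formula_depth_Or_le) auto
  have bit: "formula_depth (bit_formula L g k) \<le> Suc (Suc D)" for g k
    unfolding bit_formula_def using assms
    by (intro formula_depth_Or_le, clarsimp simp del: formula_depth.simps)
      (intro formula_depth_And_le, auto)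
  have "formula_depth (Neg (And [bit_formula L g k, bit_formula L h k])) \<le> Suc (Suc (Suc (Suc D)))" for g h k
    using bit by simp
  then have "formula_depth (And (map (\<lambda>k. Neg (And [bit_formula L g k, bit_formula L h k])) [0..<d])) \<le>
      Suc (Suc (Suc (Suc (Suc D))))" for g h
    by (intro formula_depth_And_le) (auto simp del: formula_depth.simps)
  then have "formula_depth (pair_formula L d g h) \<le> Suc (Suc (Suc (Suc (Suc (Suc D)))))" for g h
    unfolding pair_formula_def using some[of g] some[of h]
    by (intro formula_depth_And_le) (auto simp del: formula_depth.simps)
  then have "formula_depth (grouped_formula L n d m) \<le> Suc (Suc (Suc (Suc (Suc (Suc (Suc D))))))"
    unfolding grouped_formula_def by (intro formula_depth_Or_le) (auto simp del: formula_depth.simps)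
  then show ?thesis by simp
qed

text \<open>About \<open>(n / m)\<^sup>2\<close> pairs of groups each cost about
  \<open>d * m * s\<close>. Grouping therefore saves a factor \<open>m\<close> compared with testing
  all pairs of rows.\<close>

lemma size_grouped_formula:
  assumes L: "\<And>i. formula_size (L i) \<le> s" and m: "m > 0"
  shows "formula_size (grouped_formula L n d m) \<le> 1 + (Suc (n div m))\<^sup>2 * (d + 1) * (2 * m * (s + 2) + 4)"
proof -
  let ?T = "1 + m * (s + 2)"
  have some: "formula_size (some_formula L (index_group n m g)) \<le> ?T" for g
  proof -
    have "formula_size (some_formula L (index_group n m g)) \<le> 1 + length (index_group n m g) * s"
      unfolding some_formula_def using L by (intro formula_size_Or_map_le) auto
    also have "\<dots> \<le> ?T" using length_index_group[OF m, of n g] by (intro add_mono mult_mono) auto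
    finally show ?thesis .
  qed
  have bit: "formula_size (bit_formula L (index_group n m g) k) \<le> ?T" for g k
  proof -
    have "formula_size (bit_formula L (index_group n m g) k) \<le> 1 + length (index_group n m g) * (s + 2)"
      unfolding bit_formula_def using L by (intro formula_size_Or_map_le) auto
    also have "\<dots> \<le> ?T" using length_index_group[OF m, of n g] by (intro add_mono mult_mono) auto
    finally show ?thesis .
  qed
  have pair: "formula_size (pair_formula L d (index_group n m g) (index_group n m h)) \<le> (d + 1) * (2 * ?T + 2)" for g h
  proof -
    have "formula_size (Neg (And [bit_formula L (index_group n m g) k, bit_formula L (index_group n m h) k])) \<le> 2 * ?T + 2" for k
      using bit[of g k] bit[of h k] by simp
    then have "formula_size (And (map (\<lambda>k. Neg (And [bit_formula L (index_group n m g) k, bit_formula L (index_group n m h) k])) [0..<d]))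
       \<le> 1 + length [0..<d] * (2 * ?T + 2)"
      by (intro formula_size_And_map_le) blast
    then show ?thesis using some[of g] some[of h] unfolding pair_formula_def by simp
  qed
  have "formula_size (grouped_formula L n d m) \<le>
     1 + length (List.product [0..<Suc (n div m)] [0..<Suc (n div m)]) * ((d + 1) * (2 * ?T + 2))"
    unfolding grouped_formula_def using pair by (intro formula_size_Or_map_le) auto
  then show ?thesis by (simp add: power2_eq_square algebra_simps)
qed

lemma eval_pair_formula:
  "eval_formula x (pair_formula L d g h) \<longleftrightarrow>
     (\<exists>i\<in>set g. eval_formula x (L i)) \<and> (\<exists>j\<in>set h. eval_formula x (L j)) \<and>
     (\<forall>k<d. \<not> ((\<exists>i\<in>set g. eval_formula x (L i) \<and> x (i, k)) \<and>
                (\<exists>j\<in>set h. eval_formula x (L j) \<and> x (j, k))))"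
  by (simp add: pair_formula_def some_formula_def bit_formula_def) (simp add: Ball_def)

lemma eval_grouped_formula:
  "eval_formula x (grouped_formula L n d m) \<longleftrightarrow> (\<exists>g\<le>n div m. \<exists>h\<le>n div m.
     (\<exists>i<n. i div m = g \<and> eval_formula x (L i)) \<and> (\<exists>j<n. j div m = h \<and> eval_formula x (L j)) \<and>
     (\<forall>k<d. \<not> ((\<exists>i<n. i div m = g \<and> eval_formula x (L i) \<and> x (i, k)) \<and>
                (\<exists>j<n. j div m = h \<and> eval_formula x (L j) \<and> x (j, k)))))"
  by (simp add: grouped_formula_def eval_pair_formula Bex_def less_Suc_eq_le conj_assoc split_beta
      del: upt_Suc)

text \<open>A group vector dominates each selected member coordinatewise, so orthogonality of two
  group vectors passes to any members selected from them. This holds for every selection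
  \<open>L\<close>.\<close>

lemma grouped_formula_sound:
  assumes "eval_formula (case_prod v) (grouped_formula L n d m)"
  shows "\<exists>i<n. \<exists>j<n. orth d (v i) (v j)"
proof -
  obtain g h i j where *: "i < n" "i div m = g" "eval_formula (case_prod v) (L i)"
      "j < n" "j div m = h" "eval_formula (case_prod v) (L j)"
    and no: "\<forall>k<d. \<not> ((\<exists>i<n. i div m = g \<and> eval_formula (case_prod v) (L i) \<and> v i k) \<and>
                (\<exists>j<n. j div m = h \<and> eval_formula (case_prod v) (L j) \<and> v j k))"
    using assms unfolding eval_grouped_formula by auto
  then have "orth d (v i) (v j)" unfolding orth_def by blast
  with * show ?thesis by blast
qed

text \<open>Isolation collapses both group vectors to the rows \<open>v i\<close> and
  \<open>v j\<close>, whose orthogonality is then tested exactly.\<close>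

lemma grouped_formula_complete:
  assumes ij: "i < n" "j < n" "orth d (v i) (v j)"
    and iso: "isolated p l B n m v i" "isolated p l B n m v j"
  shows "eval_formula (case_prod v) (grouped_formula (light_formula p l B) n d m)"
  unfolding eval_grouped_formula eval_light_formula
proof (intro exI conjI)
  show "i div m \<le> n div m" "j div m \<le> n div m" using ij by (simp_all add: div_le_mono)
  show "i < n" "i div m = i div m" "j < n" "j div m = j div m" by (rule ij refl)+
  show "light p l B (v i)" "light p l B (v j)" using iso by (simp_all add: isolated_def)
  show "\<forall>k<d. \<not> ((\<exists>i'<n. i' div m = i div m \<and> light p l B (v i') \<and> (case (i', k) of (i, k) \<Rightarrow> v i k)) \<and>
      (\<exists>j'<n. j' div m = j div m \<and> light p l B (v j') \<and> (case (j', k) of (i, k) \<Rightarrow> v i k)))"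
    using iso ij unfolding isolated_def orth_def by auto
qed

lemma grouped_formula_error:
  assumes p: "0 < p" "p < 1" and d: "B * l \<le> d" and m: "m > 0"
  shows "measure_pmf.prob (OV_dist p n d)
      {x. eval_formula x (grouped_formula (light_formula p l B) n d m) \<noteq> OV n d x} \<le>
    (1 - p\<^sup>2) ^ d * (real n * real m + 2 * real n ^ 2 * (real B * bhatt p ^ l + real m * bhatt p ^ (B * l)))"
proof -
  have "measure_pmf.prob (OV_dist p n d)
      {x. eval_formula x (grouped_formula (light_formula p l B) n d m) \<noteq> OV n d x} \<le>
    measure_pmf.prob (rows_pmf p n d) {v. (\<exists>i<n. \<exists>j<n. orth d (v i) (v j)) \<and>
      \<not> (\<exists>i<n. \<exists>j<n. orth d (v i) (v j) \<and> isolated p l B n m v i \<and> isolated p l B n m v j)}"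
    unfolding prob_OV_dist OV_case_prod
    by (intro measure_pmf.finite_measure_mono)
      (auto dest: grouped_formula_sound intro: grouped_formula_complete)
  also note prob_no_isolated_pair_le[OF p d m]
  finally show ?thesis .
qed

section \<open>An exact formula for small dimension\<close>

text \<open>\<open>S\<close> is a guess for a set on which one vector vanishes while the other
  vanishes on its complement; two vectors are orthogonal iff such a set exists. Once
  \<open>S\<close> is fixed the two indices decouple, so the size is linear in
  \<open>n\<close>.\<close>

definition exact_formula :: "nat \<Rightarrow> nat \<Rightarrow> (nat \<times> nat) formula" where
  "exact_formula n d = Or (map (\<lambda>S. And
     [Or (map (\<lambda>i. And (map (\<lambda>k. Neg (Var (i, k))) S)) [0..<n]),
      Or (map (\<lambda>j. And (map (\<lambda>k. Neg (Var (j, k))) (filter (\<lambda>k. k \<notin> set S) [0..<d]))) [0..<n])])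
     (List.subseqs [0..<d]))"

lemma subseqs_upt_subset: "S \<in> set (List.subseqs [0..<d]) \<Longrightarrow> set S \<subseteq> {..<d}"
  using subseqs_powset[of "[0..<d]"] by (metis Pow_iff atLeast0LessThan image_eqI set_upt)

lemma eval_exact_formula: "eval_formula (case_prod v) (exact_formula n d) \<longleftrightarrow> (\<exists>i<n. \<exists>j<n. orth d (v i) (v j))"
proof -
  have "eval_formula (case_prod v) (exact_formula n d) \<longleftrightarrow>
    (\<exists>S\<in>set ` set (List.subseqs [0..<d]). (\<exists>i<n. \<forall>k\<in>S. \<not> v i k) \<and> (\<exists>j<n. \<forall>k<d. k \<notin> S \<longrightarrow> \<not> v j k))"
    by (auto simp: exact_formula_def Bex_def)
  also have "\<dots> \<longleftrightarrow> (\<exists>i<n. \<exists>j<n. orth d (v i) (v j))"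
  proof
    assume "\<exists>i<n. \<exists>j<n. orth d (v i) (v j)"
    then obtain i j where ij: "i < n" "j < n" "orth d (v i) (v j)" by blast
    then show "\<exists>S\<in>set ` set (List.subseqs [0..<d]). (\<exists>i<n. \<forall>k\<in>S. \<not> v i k) \<and> (\<exists>j<n. \<forall>k<d. k \<notin> S \<longrightarrow> \<not> v j k)"
      unfolding subseqs_powset
      by (intro bexI[of _ "{k. k < d \<and> \<not> v i k}"]) (auto simp: orth_def)
  qed (auto simp: subseqs_powset orth_def, blast)
  finally show ?thesis .
qed

lemma vars_exact_formula: "vars (exact_formula n d) \<subseteq> bits n d"
proof -
  have "\<forall>S\<in>set (List.subseqs [0..<d]). set S \<subseteq> {..<d}"
    using subseqs_upt_subset by blast
  then show ?thesis by (auto simp: exact_formula_def bits_def simp del: in_set_subseqs)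
qed

lemma depth_exact_formula: "formula_depth (exact_formula n d) \<le> 5"
proof -
  have a: "formula_depth (Or (map (\<lambda>i. And (map (\<lambda>k. Neg (Var (i, k))) S)) xs)) \<le> Suc (Suc (Suc 0))"
    for S :: "nat list" and xs :: "nat list"
    by (intro formula_depth_Or_le, clarsimp simp del: formula_depth.simps)
      (intro formula_depth_And_le, auto)
  have "formula_depth (exact_formula n d) \<le> Suc (Suc (Suc (Suc (Suc 0))))"
    unfolding exact_formula_def
    by (intro formula_depth_Or_le, clarsimp simp del: formula_depth.simps)
      (intro formula_depth_And_le, use a in \<open>auto simp del: formula_depth.simps\<close>)
  then show ?thesis by simp
qed

lemma size_exact_formula: "formula_size (exact_formula n d) \<le> 1 + 2 ^ d * (3 + 2 * (n * (1 + 2 * d)))"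
proof -
  have a: "formula_size (Or (map (\<lambda>i. And (map (\<lambda>k. Neg (Var (i, k))) S)) [0..<n])) \<le> 1 + n * (1 + 2 * d)"
    if "length S \<le> d" for S
  proof -
    have "formula_size (Or (map (\<lambda>i. And (map (\<lambda>k. Neg (Var (i, k))) S)) [0..<n])) \<le>
       1 + length [0..<n] * (1 + length S * 2)"
      by (intro formula_size_Or_map_le formula_size_And_map_le) auto
    also have "\<dots> \<le> 1 + n * (1 + 2 * d)" using that by simp
    finally show ?thesis .
  qed
  have len: "length S \<le> d" if "S \<in> set (List.subseqs [0..<d])" for S
  proof -
    have "distinct S" using that subseqs_distinctD by fastforce
    then have "length S = card (set S)" by (simp add: distinct_card)
    also have "\<dots> \<le> card {..<d}" using subseqs_upt_subset[OF that] by (intro card_mono) auto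
    finally show ?thesis by simp
  qed
  have "formula_size (exact_formula n d) \<le> 1 + length (List.subseqs [0..<d]) * (3 + 2 * (n * (1 + 2 * d)))"
    unfolding exact_formula_def
  proof (rule formula_size_Or_map_le)
    fix S assume S: "S \<in> set (List.subseqs [0..<d])"
    have "length (filter (\<lambda>k. k \<notin> set S) [0..<d]) \<le> d"
      using length_filter_le[of _ "[0..<d]"] by simp
    from a[OF this] a[OF len[OF S]]
    show "formula_size (And [Or (map (\<lambda>i. And (map (\<lambda>k. Neg (Var (i, k))) S)) [0..<n]),
        Or (map (\<lambda>j. And (map (\<lambda>k. Neg (Var (j, k))) (filter (\<lambda>k. k \<notin> set S) [0..<d]))) [0..<n])])
        \<le> 3 + 2 * (n * (1 + 2 * d))" by simp
  qed
  then show ?thesis by (simp add: length_subseqs)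
qed

section \<open>Choice of parameters\<close>

definition approximable :: "real \<Rightarrow> nat \<Rightarrow> real \<Rightarrow> nat \<Rightarrow> nat \<Rightarrow> real \<Rightarrow> bool" where
  "approximable p D s n d e \<longleftrightarrow> (\<exists>F :: (nat \<times> nat) formula. vars F \<subseteq> bits n d \<and> formula_depth F \<le> D \<and>
     real (formula_size F) \<le> s \<and>
     measure_pmf.prob (OV_dist p n d) {x. eval_formula x F \<noteq> OV n d x} \<le> e)"

lemma approximable_mono:
  "approximable p D s n d e \<Longrightarrow> D \<le> D' \<Longrightarrow> e \<le> e' \<Longrightarrow> approximable p D' s n d e'"
  unfolding approximable_def by (meson order_trans)

lemma approximable_trivial:
  assumes "s \<ge> 1"
  shows "approximable p 1 s n d 1"
  unfolding approximable_def by (intro exI[of _ "And []"]) (use assms in auto)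

lemma approximable_const_False:
  assumes "p \<in> {0..1}" "s \<ge> 1"
  shows "approximable p 1 s n d (real n ^ 2 * (1 - p\<^sup>2) ^ d)"
  unfolding approximable_def
  by (intro exI[of _ "Or []"])
    (use assms prob_rows_OV_le[of p n d] in \<open>auto simp: prob_OV_dist OV_case_prod\<close>)

lemma approximable_const_True:
  assumes "s \<ge> 1"
    and "measure_pmf.prob (rows_pmf p n d) {v. \<forall>i<n. \<forall>j<n. \<not> orth d (v i) (v j)} \<le> e"
  shows "approximable p 1 s n d e"
  unfolding approximable_def
  by (intro exI[of _ "And []"]) (use assms in \<open>auto simp: prob_OV_dist OV_case_prod\<close>)

lemma approximable_exact:
  assumes "real (formula_size (exact_formula n d)) \<le> s" "0 \<le> e"
  shows "approximable p 5 s n d e"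
proof -
  have "measure_pmf.prob (OV_dist p n d) {x. eval_formula x (exact_formula n d) \<noteq> OV n d x} = 0"
    by (simp only: prob_OV_dist OV_case_prod eval_exact_formula simp_thms) simp
  with assms vars_exact_formula depth_exact_formula show ?thesis
    unfolding approximable_def by (intro exI[of _ "exact_formula n d"]) auto
qed

lemma approximable_grouped:
  assumes p: "0 < p" "p < 1" and d: "B * l \<le> d" and m: "m > 0"
    and s: "real (1 + (Suc (n div m))\<^sup>2 * (d + 1) * (2 * m * (1 + B * (1 + 2 ^ l * (1 + 2 * l)) + 2) + 4)) \<le> s"
  shows "approximable p 11 s n d
    ((1 - p\<^sup>2) ^ d * (real n * real m + 2 * real n ^ 2 * (real B * bhatt p ^ l + real m * bhatt p ^ (B * l))))"
  unfolding approximable_def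
proof (intro exI conjI)
  let ?F = "grouped_formula (light_formula p l B) n d m"
  show "vars ?F \<subseteq> bits n d"
    using d by (intro vars_grouped_formula vars_light_formula)
  show "formula_depth ?F \<le> 11"
    using depth_grouped_formula[of "light_formula p l B" 4] depth_light_formula by simp
  have "formula_size ?F \<le>
      1 + (Suc (n div m))\<^sup>2 * (d + 1) * (2 * m * (1 + B * (1 + 2 ^ l * (1 + 2 * l)) + 2) + 4)"
    by (intro size_grouped_formula size_light_formula m)
  with s show "real (formula_size ?F) \<le> s" by (meson of_nat_mono order_trans)
  show "measure_pmf.prob (OV_dist p n d) {x. eval_formula x ?F \<noteq> OV n d x} \<le>
    (1 - p\<^sup>2) ^ d * (real n * real m + 2 * real n ^ 2 * (real B * bhatt p ^ l + real m * bhatt p ^ (B * l)))"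
    by (rule grouped_formula_error[OF p d m])
qed

text \<open>\<open>\<delta>\<close> and \<open>D\<close> are chosen before \<open>n\<close> and
  \<open>d\<close>, which expresses constant depth and a uniform error. At \<open>n = 0\<close> the
  size bound is 0, which no formula meets, hence \<open>n \<ge> 1\<close>.\<close>

definition approximable_family :: "real \<Rightarrow> real \<Rightarrow> bool" where
  "approximable_family p \<epsilon> \<longleftrightarrow> (\<exists>(\<delta> :: nat \<Rightarrow> real) D. \<delta> \<longlonglongrightarrow> 0 \<and>
     (\<forall>n\<ge>1. \<forall>d. approximable p D (real n powr (2 - \<epsilon>)) n d (\<delta> n)))"

text \<open>Small \<open>n\<close> are handled by a constant formula with error bound 1. Changing
  \<open>\<delta>\<close> at finitely many places preserves its limit, and
  \<open>\<epsilon> \<le> 2\<close> leaves room for one node.\<close>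

lemma approximable_familyI:
  assumes "\<epsilon> \<le> 2" "\<delta> \<longlonglongrightarrow> 0"
    and ev: "eventually (\<lambda>n. \<forall>d. approximable p D (real n powr (2 - \<epsilon>)) n d (\<delta> n)) sequentially"
  shows "approximable_family p \<epsilon>"
proof -
  define \<delta>' where "\<delta>' n = (if \<forall>d. approximable p D (real n powr (2 - \<epsilon>)) n d (\<delta> n) then \<delta> n else 1)" for n
  have "eventually (\<lambda>n. \<delta> n = \<delta>' n) sequentially"
    using ev by eventually_elim (simp add: \<delta>'_def)
  with assms(2) have "\<delta>' \<longlonglongrightarrow> 0" by (rule Lim_transform_eventually)
  moreover have "approximable p (max D 1) (real n powr (2 - \<epsilon>)) n d (\<delta>' n)" if "n \<ge> 1" for n d
  proof (cases "\<forall>d. approximable p D (real n powr (2 - \<epsilon>)) n d (\<delta> n)")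
    case True
    then show ?thesis by (auto simp: \<delta>'_def intro: approximable_mono)
  next
    case False
    have "real n powr (2 - \<epsilon>) \<ge> 1" using that assms(1) by (intro ge_one_powr_ge_zero) auto
    from approximable_trivial[OF this] have "approximable p 1 (real n powr (2 - \<epsilon>)) n d 1" .
    moreover have "\<delta>' n = 1" using False by (simp only: \<delta>'_def if_False)
    ultimately show ?thesis by (auto intro: approximable_mono)
  qed
  ultimately show ?thesis unfolding approximable_family_def by blast
qed

section \<open>Regimes of the dimension around the threshold\<close>

definition rate :: "real \<Rightarrow> real" where
  "rate p = - ln (1 - p\<^sup>2)"

lemma rate_pos: "0 < p \<Longrightarrow> p < 1 \<Longrightarrow> 0 < rate p"
  by (simp add: rate_def abs_square_less_1)

lemma one_minus_square_pow:
  assumes "0 < p" "p < 1"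
  shows "(1 - p\<^sup>2) ^ d = exp (- rate p * real d)"
  using assms by (simp add: rate_def abs_square_less_1 exp_of_nat2_mult)

text \<open>The threshold is at \<open>2 * ln n\<close>; with 3 in place of 2 the expected number of
  orthogonal pairs drops below \<open>1 / n\<close>. In all other regimes \<open>d\<close> is then
  logarithmic in \<open>n\<close>.\<close>

lemma approximable_large_dim:
  assumes p: "0 < p" "p < 1" and n: "n \<ge> 1" and d: "3 * ln n < rate p * real d" and s: "s \<ge> 1"
  shows "approximable p 1 s n d (1 / n)"
proof -
  have n0: "real n > 0" using n by simp
  have "real n ^ 2 * (1 - p\<^sup>2) ^ d = exp (2 * ln n) * exp (- rate p * real d)"
    using n0 one_minus_square_pow[OF p] by (simp add: exp_double)
  also have "\<dots> = exp (2 * ln n - rate p * real d)" by (simp flip: exp_add)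
  also have "\<dots> \<le> exp (- ln n)" using d by simp
  also have "\<dots> = 1 / n" using n0 by (simp add: exp_minus field_simps)
  finally show ?thesis
    using p s by (intro approximable_mono[OF approximable_const_False]) auto
qed

text \<open>If \<open>d\<close> is at most \<open>3 * ln n / rate p\<close>, then
  \<open>2 ^ d\<close> is at most \<open>n powr (3 / rate p)\<close>. The exact formula costs this
  times \<open>n\<close> and a logarithmic factor, and the latter is absorbed by another
  \<open>n powr (1 / rate p)\<close>.\<close>

lemma approximable_family_near_1:
  assumes p: "0 < p" "p < 1" and L: "rate p \<ge> 8"
  shows "approximable_family p (1 - 4 / rate p)"
proof (rule approximable_familyI)
  define L where "L = rate p"
  have Lp: "L \<ge> 8" using L by (simp add: L_def)
  define a where "a = 1 / L"
  have a: "a > 0" using Lp by (simp add: a_def)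
  show "(\<lambda>n. 1 / real n) \<longlonglongrightarrow> 0" by real_asymp
  have "eventually (\<lambda>n. 12 * (1 + ln (real n)) \<le> real n powr a) sequentially"
    using a by real_asymp
  then show "eventually (\<lambda>n. \<forall>d. approximable p 5 (real n powr (2 - (1 - 4 / rate p))) n d (1 / real n)) sequentially"
    using eventually_ge_at_top[of 1]
  proof eventually_elim
    case (elim n)
    have n: "real n > 0" "ln (real n) \<ge> 0" using elim by auto
    have s: "1 \<le> real n powr (2 - (1 - 4 / rate p))"
      using elim Lp by (intro ge_one_powr_ge_zero) (auto simp: L_def)
    show ?case
    proof
      fix d
      show "approximable p 5 (real n powr (2 - (1 - 4 / rate p))) n d (1 / real n)"
      proof (cases "3 * ln n < rate p * real d")
        case True
        from approximable_large_dim[OF p elim(2) this s] show ?thesis by (rule approximable_mono) auto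
      next
        case False
        then have d: "real d \<le> 3 * ln n / L" using Lp by (simp add: L_def field_simps)
        also have "\<dots> \<le> 1 * ln n" using n Lp by (simp add: field_simps mult_right_mono)
        finally have d1: "real d \<le> ln n" by simp
        have "2 ^ d = exp (real d * ln 2)" by (simp add: exp_of_nat_mult)
        also have "\<dots> \<le> exp (3 * ln n / L * 1)"
          using d ln_2_less_1 by (subst exp_le_cancel_iff, intro mult_mono) (use n Lp in auto)
        also have "\<dots> = real n powr (3 * a)" using n by (simp add: powr_def a_def)
        finally have pow: "2 ^ d \<le> real n powr (3 * a)" .
        have one: "1 \<le> real n powr (3 * a) * real n" using elim(2) a
          by (intro mult_ge1_I ge_one_powr_ge_zero) auto
        have "real (formula_size (exact_formula n d)) \<le> real (1 + 2 ^ d * (3 + 2 * (n * (1 + 2 * d))))"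
          using size_exact_formula by (rule of_nat_mono)
        also have "\<dots> = 1 + 2 ^ d * (3 * 1 + 2 * (real n * (1 + 2 * real d)))" by (simp add: algebra_simps)
        also have "\<dots> \<le> 1 + real n powr (3 * a) * (3 * real n + 2 * (real n * (1 + 2 * ln n)))"
          using pow d1 elim(2) n by (intro add_left_mono mult_mono add_mono) auto
        also have "\<dots> \<le> real n powr (3 * a) * real n + real n powr (3 * a) * (3 * real n + 2 * (real n * (1 + 2 * ln n)))"
          using one by simp
        also have "\<dots> = real n powr (3 * a) * real n * (6 + 4 * ln n)" by (simp add: algebra_simps)
        also have "\<dots> \<le> real n powr (3 * a) * real n * (12 * (1 + ln n))"
          using n by (intro mult_left_mono) auto
        also have "\<dots> \<le> real n powr (3 * a) * real n * real n powr a"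
          using elim(1) by (intro mult_left_mono) auto
        also have "\<dots> = real n powr (3 * a) * real n powr 1 * real n powr a" using n by simp
        also have "\<dots> = real n powr (2 - (1 - 4 / rate p))"
          unfolding powr_add[symmetric] by (simp add: a_def L_def add.commute)
        finally show ?thesis by (intro approximable_exact) auto
      qed
    qed
  qed
qed (use L in \<open>simp add: field_simps\<close>)

text \<open>At least \<open>n powr w\<close> orthogonal pairs are expected, so the constant true is
  tried. The second moment bound gains about \<open>n powr (w / 2)\<close> and loses at most
  \<open>n powr (w / 4)\<close> through the spread of the weights in the typical set.\<close>

lemma approximable_below_threshold:
  assumes p: "0 < p" "p < 1" and w: "0 < w"
  obtains C where
    "eventually (\<lambda>n. \<forall>d s. s \<ge> 1 \<longrightarrow> rate p * real d \<le> 3 * ln n \<longrightarrow>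
       real n powr w \<le> real n ^ 2 * (1 - p\<^sup>2) ^ d \<longrightarrow>
       approximable p 1 s n d (C * (real n powr (- w / 4) + 1 / n))) sequentially"
proof -
  define L where "L = rate p"
  have L: "L > 0" using rate_pos[OF p] by (simp add: L_def)
  define A where "A = - ln (1 - p)"
  have A: "A > 0" using p by (simp add: A_def)
  \<comment> \<open>Chosen so that \<open>(1 - p) powr (- 2 * \<eta> * real d)\<close> is at most
    \<open>n powr (w / 4)\<close> whenever \<open>rate p * real d \<le> 3 * ln n\<close>.\<close>
  define \<eta> where "\<eta> = w * L / (24 * A)"
  have \<eta>: "\<eta> > 0" using L A w by (simp add: \<eta>_def)
  \<comment> \<open>Positive dimensions violating the concentration hypothesis of
    \<open>no_orth_large_dim\<close> are below \<open>K\<close>. They are left to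
    \<open>no_orth_small_dim\<close>, with \<open>(1 - p\<^sup>2) ^ d\<close> at least
    \<open>exp (- (L * K))\<close>.\<close>
  define K where "K = ln 8 / (2 * \<eta>\<^sup>2)"
  have K: "K \<ge> 0" by (simp add: K_def)
  define C where "C = max 24 (9 * exp (L * K))"
  have "eventually (\<lambda>n. 3 \<le> real n powr (w / 2)) sequentially" using w by real_asymp
  then have "eventually (\<lambda>n. \<forall>d s. s \<ge> 1 \<longrightarrow> rate p * real d \<le> 3 * ln n \<longrightarrow>
       real n powr w \<le> real n ^ 2 * (1 - p\<^sup>2) ^ d \<longrightarrow>
       approximable p 1 s n d (C * (real n powr (- w / 4) + 1 / n))) sequentially"
    using eventually_ge_at_top[of 2]
  proof eventually_elim
    case (elim n)
    show ?case
    proof (intro allI impI)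
      fix d :: nat and s :: real
      assume s: "s \<ge> 1" and d: "rate p * real d \<le> 3 * ln n"
        and q: "real n powr w \<le> real n ^ 2 * (1 - p\<^sup>2) ^ d"
      define N where "N = n div 2"
      have "n \<le> 3 * N" using elim(2) unfolding N_def by linarith
      then have N: "N > 0" "2 * N \<le> n" "real n / 3 \<le> real N" using elim(2) by (auto simp: N_def)
      have n: "real n > 0" using elim by simp
      have q0: "(1 - p\<^sup>2) ^ d > 0" using one_minus_square_pow[OF p] by simp
      have "measure_pmf.prob (rows_pmf p n d) {v. \<forall>i<n. \<forall>j<n. \<not> orth d (v i) (v j)} \<le>
        C * (real n powr (- w / 4) + 1 / n)"
      proof (cases "ln 8 \<le> 2 * \<eta>\<^sup>2 * real d \<and> d > 0")
        case True
        have "real n powr (w / 2) = sqrt (real n powr w)"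
          using n by (simp add: powr_half_sqrt[symmetric] powr_powr)
        also have "\<dots> \<le> sqrt (real n ^ 2 * (1 - p\<^sup>2) ^ d)" using q by simp
        also have "\<dots> = real n * sqrt ((1 - p\<^sup>2) ^ d)" by (simp add: real_sqrt_mult)
        also have "\<dots> \<le> 3 * real N * sqrt ((1 - p\<^sup>2) ^ d)"
          using N q0 by (intro mult_right_mono) auto
        finally have Y: "real n powr (w / 2) / 3 \<le> real N * sqrt ((1 - p\<^sup>2) ^ d)" by simp
        have "(1 - p) powr (- 2 * \<eta> * real d) = exp (2 * \<eta> * A * real d)"
          using p by (simp add: powr_def A_def)
        also have "2 * \<eta> * A * real d = w / 12 * (L * real d)" using A by (simp add: \<eta>_def)
        also have "exp \<dots> \<le> exp (w / 12 * (3 * ln n))" using d w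
          by (subst exp_le_cancel_iff, intro mult_left_mono) (auto simp: L_def)
        also have "\<dots> = real n powr (w / 4)" using n by (simp add: powr_def)
        finally have \<kappa>: "(1 - p) powr (- 2 * \<eta> * real d) \<le> real n powr (w / 4)" .
        have "measure_pmf.prob (rows_pmf p n d) {v. \<forall>i<n. \<forall>j<n. \<not> orth d (v i) (v j)} \<le>
            8 * (1 - p) powr (- 2 * \<eta> * real d) / (real N * sqrt ((1 - p\<^sup>2) ^ d))"
          using True Y elim(1) by (intro no_orth_large_dim[OF p N(1,2) \<eta>]) auto
        also have "\<dots> \<le> 8 * real n powr (w / 4) / (real n powr (w / 2) / 3)"
          using \<kappa> Y n by (intro frac_le mult_left_mono) auto
        also have "\<dots> = 24 * real n powr (w / 4 - w / 2)" by (subst powr_diff) simp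
        also have "w / 4 - w / 2 = - w / 4" by simp
        also have "24 * real n powr (- w / 4) \<le> C * (real n powr (- w / 4) + 1 / n)"
          by (intro mult_mono) (auto simp: C_def)
        finally show ?thesis .
      next
        case False
        have "real d \<le> K"
        proof (cases "d > 0")
          case True
          with False have "real d * (2 * \<eta>\<^sup>2) \<le> ln 8" by (simp add: mult.commute)
          then show ?thesis using \<eta> by (simp add: K_def pos_le_divide_eq)
        qed (use K in simp)
        then have c: "exp (- (L * K)) \<le> (1 - p\<^sup>2) ^ d"
          using L by (simp add: one_minus_square_pow[OF p] L_def)
        have "measure_pmf.prob (rows_pmf p n d) {v. \<forall>i<n. \<forall>j<n. \<not> orth d (v i) (v j)} \<le>
            3 / (real N * (1 - p\<^sup>2) ^ d)"
          by (rule no_orth_small_dim[OF p N(1,2)])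
        also have "\<dots> \<le> 3 / (real n / 3 * exp (- (L * K)))"
          using c q0 N n by (intro divide_left_mono mult_mono mult_pos_pos) auto
        also have "\<dots> = 9 * exp (L * K) * (1 / n)" by (simp add: exp_minus field_simps)
        also have "\<dots> \<le> C * (real n powr (- w / 4) + 1 / n)"
          by (intro mult_mono) (auto simp: C_def)
        finally show ?thesis .
      qed
      with s show "approximable p 1 s n d (C * (real n powr (- w / 4) + 1 / n))"
        by (rule approximable_const_True)
    qed
  qed
  then show ?thesis by (rule that)
qed

text \<open>The grouped formula with blocks of length about \<open>\<tau> * ln n\<close> and groups
  of size about \<open>n powr \<tau>\<close>. All parameters depend on \<open>p\<close> only, and
  \<open>w\<close> fixes the width of the window around the threshold.\<close>

lemma approximable_near_threshold:
  assumes p: "0 < p" "p < 1"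
  obtains \<epsilon> w C where "0 < \<epsilon>" "\<epsilon> \<le> 2" "0 < w"
    "eventually (\<lambda>n. \<forall>d. rate p * real d \<le> 3 * ln n \<longrightarrow>
       real n ^ 2 * (1 - p\<^sup>2) ^ d \<le> real n powr w \<longrightarrow>
       approximable p 11 (real n powr (2 - \<epsilon>)) n d (real n powr (- 1 / 2) + C * real n powr (- w))) sequentially"
proof -
  define L where "L = rate p"
  have L: "L > 0" using rate_pos[OF p] by (simp add: L_def)
  define b where "b = - ln (bhatt p)"
  have b: "b > 0" using bhatt_pos[OF p] bhatt_less_1[OF p] by (simp add: b_def)
  have bhatt_pow: "bhatt p ^ k = exp (- b * real k)" for k
    using bhatt_pos[OF p] by (simp add: b_def exp_of_nat2_mult)
  \<comment> \<open>With \<open>b * real B \<ge> 1 + b\<close> the false positive rate, about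
    \<open>n powr (- b * real B * \<tau>)\<close>, stays of order at most
    \<open>n powr (- b * \<tau>)\<close> even after multiplication by the group size.\<close>
  define B where "B = nat \<lceil>1 / b\<rceil> + 1"
  have "1 / b \<le> real B - 1" by (simp add: B_def) linarith
  then have B: "1 + b \<le> b * real B" using b by (simp add: field_simps)
  have B0: "real B > 0" by (simp add: B_def)
  \<comment> \<open>The bound \<open>1 / (real B * L)\<close> makes all blocks fit into the
    \<open>d\<close> coordinates; \<open>1 / 4\<close> keeps the contribution of pairs inside one
    group small.\<close>
  define \<tau> where "\<tau> = min (1 / 4) (1 / (real B * L))"
  have \<tau>: "0 < \<tau>" "\<tau> \<le> 1 / 4" "real B * \<tau> \<le> 1 / L"
    using B0 L by (auto simp: \<tau>_def min_def field_simps)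
  \<comment> \<open>Up to \<open>n powr w\<close> expected pairs, each missed with probability of
    order \<open>n powr (- b * \<tau>)\<close>, leave an error of order
    \<open>n powr (- w)\<close>.\<close>
  define w where "w = min (b * \<tau> / 2) (1 / 4)"
  have w: "0 < w" "w \<le> b * \<tau> / 2" "w \<le> 1 / 4" using b \<tau> by (auto simp: w_def)
  \<comment> \<open>Grouping saves the exponent \<open>\<tau>\<close> and the light test costs
    \<open>\<tau> * ln 2\<close>. Half of the difference is given up to absorb constants and
    logarithmic factors.\<close>
  define \<epsilon> where "\<epsilon> = \<tau> * (1 - ln 2) / 2"
  have \<epsilon>: "0 < \<epsilon>" "\<epsilon> \<le> 2" using \<tau> ln_2_less_1 mult_mono[of \<tau> "1/4" "1 - ln 2" 1] by (auto simp: \<epsilon>_def)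
  define C where "C = 2 * (real B * exp b + exp (b * real B))"
  define c where "c = 1 + 9 * (3 / L + 1) * (2 * (3 + 3 * real B) + 4)"
  have "c > 0" using L B0 by (auto simp: c_def intro!: add_pos_pos mult_pos_pos)
  then have "eventually (\<lambda>n. c * (1 + ln (real n)) ^ 2 \<le> real n powr \<epsilon>) sequentially"
    using \<epsilon>(1) by real_asymp
  moreover have "eventually (\<lambda>n. 2 \<le> real n powr \<tau>) sequentially"
    using \<tau>(1) by real_asymp
  ultimately have "eventually (\<lambda>n. \<forall>d. rate p * real d \<le> 3 * ln n \<longrightarrow>
       real n ^ 2 * (1 - p\<^sup>2) ^ d \<le> real n powr w \<longrightarrow>
       approximable p 11 (real n powr (2 - \<epsilon>)) n d (real n powr (- 1 / 2) + C * real n powr (- w))) sequentially"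
    using eventually_ge_at_top[of 1]
  proof eventually_elim
    case (elim n)
    show ?case
    proof (intro allI impI)
      fix d :: nat
      assume d: "rate p * real d \<le> 3 * ln n" and q: "real n ^ 2 * (1 - p\<^sup>2) ^ d \<le> real n powr w"
      define x where "x = real n"
      have x: "x \<ge> 1" "x > 0" "ln x \<ge> 0" using elim(3) by (auto simp: x_def)
      define l where "l = nat \<lfloor>\<tau> * ln x\<rfloor>"
      have "0 \<le> \<tau> * ln x" using \<tau> x by simp
      then have l: "real l \<le> \<tau> * ln x" "\<tau> * ln x - 1 \<le> real l" unfolding l_def by linarith+
      define m where "m = nat \<lfloor>x powr \<tau>\<rfloor>"
      have xt: "2 \<le> x powr \<tau>" using elim(2) by (simp add: x_def)
      then have m: "real m \<le> x powr \<tau>" "x powr \<tau> / 2 \<le> real m" "m > 0" unfolding m_def by linarith+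
      \<comment> \<open>At most \<open>n powr w\<close> expected pairs with \<open>w \<le> 1\<close>
        force \<open>d\<close> to be at least \<open>ln n / L\<close>.\<close>
      have Bl: "B * l \<le> d"
      proof -
        have "2 * ln x - L * real d \<le> w * ln x"
        proof -
          have "exp (2 * ln x - L * real d) = exp (2 * ln x) * exp (- rate p * real d)"
            by (simp add: L_def flip: exp_add)
          also have "\<dots> = x ^ 2 * (1 - p\<^sup>2) ^ d"
            using x by (simp add: one_minus_square_pow[OF p] exp_double)
          also have "\<dots> \<le> exp (w * ln x)" using q x by (simp add: x_def powr_def)
          finally show ?thesis by simp
        qed
        moreover have "w * ln x \<le> 1 * ln x" using w x by (intro mult_right_mono) auto
        ultimately have "ln x / L \<le> real d" using L by (simp add: field_simps)
        moreover have "real B * real l \<le> real B * (\<tau> * ln x)" using l B0 by (intro mult_left_mono) auto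
        moreover have "real B * (\<tau> * ln x) \<le> 1 / L * ln x"
          using \<tau>(3) x by (simp only: mult.assoc[symmetric]) (intro mult_right_mono)
        ultimately have "real (B * l) \<le> real d" by simp
        then show ?thesis by linarith
      qed
      have size: "real (1 + (Suc (n div m))\<^sup>2 * (d + 1) * (2 * m * (1 + B * (1 + 2 ^ l * (1 + 2 * l)) + 2) + 4))
          \<le> real n powr (2 - \<epsilon>)"
      proof -
        define y where "y = 1 + ln x"
        have y: "y \<ge> 1" using x by (simp add: y_def)
        define z where "z = x powr (\<tau> * ln 2)"
        have z: "z \<ge> 1" unfolding z_def using x \<tau> by (intro ge_one_powr_ge_zero) auto
        have "2 ^ l = exp (real l * ln 2)" by (simp add: exp_of_nat_mult)
        also have "\<dots> \<le> exp (\<tau> * ln x * ln 2)" using l by simp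
        also have "\<dots> = z" using x by (simp add: z_def powr_def mult_ac)
        finally have pow: "2 ^ l \<le> z" .
        have "\<tau> * ln x \<le> 1 * ln x" using \<tau> x by (intro mult_right_mono) auto
        then have ly: "1 + 2 * real l \<le> 2 * y" using l by (simp add: y_def)
        have "real (n div m) \<le> x / real m" unfolding x_def by (rule of_nat_div_le_of_nat)
        also have "\<dots> \<le> x / (x powr \<tau> / 2)" using m x by (intro divide_left_mono) auto
        also have "\<dots> = 2 * x powr (1 - \<tau>)" using x by (simp add: powr_diff)
        finally have "real (n div m) \<le> 2 * x powr (1 - \<tau>)" .
        moreover have "1 \<le> x powr (1 - \<tau>)" using x \<tau> by (intro ge_one_powr_ge_zero) auto
        ultimately have G: "1 + real (n div m) \<le> 3 * x powr (1 - \<tau>)" by simp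
        have "real d \<le> 3 / L * ln x" using d L by (simp add: L_def x_def field_simps)
        moreover have "3 / L * ln x \<le> 3 / L * y" using L by (intro mult_left_mono) (auto simp: y_def)
        ultimately have dy: "real d + 1 \<le> (3 / L + 1) * y" using y by (simp add: algebra_simps)
        have yz: "1 \<le> y * z" using y z by (rule mult_ge1_I)
        have "2 ^ l * (1 + 2 * real l) \<le> z * (2 * y)"
          using pow ly z by (intro mult_mono) auto
        with yz have "1 + 2 ^ l * (1 + 2 * real l) \<le> y * z + z * (2 * y)" by (rule add_mono)
        then have "real B * (1 + 2 ^ l * (1 + 2 * real l)) \<le> real B * (y * z + z * (2 * y))"
          using B0 by (intro mult_left_mono) auto
        then have "1 + real B * (1 + 2 ^ l * (1 + 2 * real l)) + 2 \<le> 3 + real B * (y * z + z * (2 * y))"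
          by simp
        also have "\<dots> \<le> 3 * (y * z) + real B * (y * z + z * (2 * y))" using yz by simp
        also have "\<dots> = (3 + 3 * real B) * (y * z)" by (simp add: algebra_simps)
        finally have s: "1 + real B * (1 + 2 ^ l * (1 + 2 * real l)) + 2 \<le> (3 + 3 * real B) * (y * z)" .
        have xz: "1 \<le> x powr \<tau> * (y * z)" using xt y z by (intro mult_ge1_I) auto
        have "2 * real m * (1 + real B * (1 + 2 ^ l * (1 + 2 * real l)) + 2) + 4 \<le>
            2 * x powr \<tau> * ((3 + 3 * real B) * (y * z)) + 4 * (x powr \<tau> * (y * z))"
          using m s xz by (intro add_mono mult_mono) auto
        also have "\<dots> = (2 * (3 + 3 * real B) + 4) * (x powr \<tau> * (y * z))" by (simp add: algebra_simps)
        finally have t: "2 * real m * (1 + real B * (1 + 2 ^ l * (1 + 2 * real l)) + 2) + 4 \<le>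
          (2 * (3 + 3 * real B) + 4) * (x powr \<tau> * (y * z))" .
        define X where "X = (x powr (1 - \<tau>))\<^sup>2 * y * (x powr \<tau> * (y * z))"
        have X: "1 \<le> X" unfolding X_def using y z x \<tau>
          by (intro mult_ge1_I one_le_power ge_one_powr_ge_zero) auto
        have "real (1 + (Suc (n div m))\<^sup>2 * (d + 1) * (2 * m * (1 + B * (1 + 2 ^ l * (1 + 2 * l)) + 2) + 4))
          = 1 + (1 + real (n div m))\<^sup>2 * (real d + 1) *
              (2 * real m * (1 + real B * (1 + 2 ^ l * (1 + 2 * real l)) + 2) + 4)"
          by (simp only: of_nat_add of_nat_mult of_nat_power of_nat_Suc of_nat_1 of_nat_numeral)
        also have "\<dots> \<le> X + (3 * x powr (1 - \<tau>))\<^sup>2 * ((3 / L + 1) * y) *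
            ((2 * (3 + 3 * real B) + 4) * (x powr \<tau> * (y * z)))"
          using G dy t X y L by (intro add_mono mult_mono power_mono) auto
        also have "\<dots> = c * X" by (simp add: X_def c_def algebra_simps power2_eq_square)
        also have "X = (x powr (1 - \<tau>))\<^sup>2 * x powr \<tau> * z * y\<^sup>2"
          by (simp add: X_def power2_eq_square mult_ac)
        also have "(x powr (1 - \<tau>))\<^sup>2 * x powr \<tau> * z = x powr (2 - 2 * \<epsilon>)"
          unfolding power2_eq_square z_def powr_add[symmetric]
          by (intro arg_cong[where f = "\<lambda>a. x powr a"]) (simp add: \<epsilon>_def field_simps)
        also have "c * (x powr (2 - 2 * \<epsilon>) * y\<^sup>2) = x powr (2 - 2 * \<epsilon>) * (c * y\<^sup>2)" by simp
        also have "\<dots> \<le> x powr (2 - 2 * \<epsilon>) * x powr \<epsilon>"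
          using elim(1) by (intro mult_left_mono) (auto simp: x_def y_def)
        also have "\<dots> = x powr (2 - \<epsilon>)" by (simp flip: powr_add)
        finally show ?thesis by (simp only: x_def)
      qed
      have "(1 - p\<^sup>2) ^ d * (real n * real m + 2 * real n ^ 2 * (real B * bhatt p ^ l + real m * bhatt p ^ (B * l)))
          \<le> real n powr (- 1 / 2) + C * real n powr (- w)"
      proof -
        have bl: "bhatt p ^ l \<le> exp b * x powr (- b * \<tau>)"
        proof -
          have "bhatt p ^ l = exp (- b * real l)" by (rule bhatt_pow)
          also have "\<dots> \<le> exp (- b * (\<tau> * ln x - 1))"
            using l b by (simp add: mult_left_mono)
          also have "\<dots> = exp b * x powr (- b * \<tau>)"
            using x by (simp add: powr_def algebra_simps flip: exp_add)
          finally show ?thesis .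
        qed
        have "bhatt p ^ (B * l) = (bhatt p ^ l) ^ B" by (simp add: power_mult[symmetric] mult.commute)
        also have "\<dots> \<le> (exp b * x powr (- b * \<tau>)) ^ B"
          using bl bhatt_pos[OF p] by (intro power_mono) auto
        also have "\<dots> = exp (b * real B) * x powr (- (b * real B) * \<tau>)"
          using x by (simp add: power_mult_distrib powr_realpow[symmetric] powr_powr exp_of_nat2_mult mult_ac)
        also have "\<dots> \<le> exp (b * real B) * x powr (- (1 + b) * \<tau>)"
          using B x \<tau> by (intro mult_left_mono powr_mono mult_right_mono) auto
        finally have bBl: "bhatt p ^ (B * l) \<le> exp (b * real B) * x powr (- (1 + b) * \<tau>)" .
        have "real m * bhatt p ^ (B * l) \<le> x powr \<tau> * (exp (b * real B) * x powr (- (1 + b) * \<tau>))"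
          using m bBl bhatt_pos[OF p] by (intro mult_mono) auto
        also have "\<dots> = exp (b * real B) * (x powr \<tau> * x powr (- (1 + b) * \<tau>))" by simp
        also have "x powr \<tau> * x powr (- (1 + b) * \<tau>) = x powr (- b * \<tau>)"
          by (simp add: algebra_simps flip: powr_add)
        finally have mb: "real m * bhatt p ^ (B * l) \<le> exp (b * real B) * x powr (- b * \<tau>)" .
        have "(1 - p\<^sup>2) ^ d * (real n * real m + 2 * real n ^ 2 * (real B * bhatt p ^ l + real m * bhatt p ^ (B * l)))
          = (real n ^ 2 * (1 - p\<^sup>2) ^ d) * (real m / x + 2 * (real B * bhatt p ^ l + real m * bhatt p ^ (B * l)))"
          using x by (simp add: x_def[symmetric] field_simps power2_eq_square)
        also have "\<dots> \<le> x powr w * (x powr \<tau> / x + 2 * (real B * (exp b * x powr (- b * \<tau>)) + exp (b * real B) * x powr (- b * \<tau>)))"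
        proof (rule mult_mono)
          have "real B * bhatt p ^ l + real m * bhatt p ^ (B * l) \<le>
              real B * (exp b * x powr (- b * \<tau>)) + exp (b * real B) * x powr (- b * \<tau>)"
            by (intro add_mono mult_left_mono bl mb) auto
          then show "real m / x + 2 * (real B * bhatt p ^ l + real m * bhatt p ^ (B * l)) \<le>
              x powr \<tau> / x + 2 * (real B * (exp b * x powr (- b * \<tau>)) + exp (b * real B) * x powr (- b * \<tau>))"
            using m x by (intro add_mono[OF divide_right_mono mult_left_mono]) auto
        qed (use q x bhatt_pos[OF p] in \<open>auto simp: x_def[symmetric]\<close>)
        also have "\<dots> = x powr w * x powr \<tau> / x powr 1 + C * (x powr w * x powr (- b * \<tau>))"
          using x by (simp add: C_def algebra_simps)
        also have "\<dots> = x powr (w + \<tau> - 1) + C * x powr (w - b * \<tau>)"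
          by (simp only: powr_add[symmetric] powr_diff[symmetric]) simp
        also have "\<dots> \<le> x powr (- 1 / 2) + C * x powr (- w)"
          using x w \<tau> by (intro add_mono mult_left_mono powr_mono) (auto simp: C_def)
        finally show ?thesis by (simp only: x_def)
      qed
      with approximable_grouped[OF p Bl m(3) size]
      show "approximable p 11 (real n powr (2 - \<epsilon>)) n d (real n powr (- 1 / 2) + C * real n powr (- w))"
        by (rule approximable_mono[OF _ order_refl])
    qed
  qed
  with \<epsilon> w that show ?thesis by blast
qed

text \<open>The near-threshold regime dictates the width \<open>w\<close>; the regime below it works
  for every positive width and so takes the same one. With the large dimensions they cover every
  \<open>d\<close>, and \<open>\<delta>\<close> is the maximum of the three error bounds.\<close>

lemma approximable_family_exists:
  assumes p: "0 < p" "p < 1"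
  obtains \<epsilon> where "0 < \<epsilon>" "approximable_family p \<epsilon>"
proof -
  obtain \<epsilon> w C where \<epsilon>: "0 < \<epsilon>" "\<epsilon> \<le> 2" and w: "0 < w"
    and near: "eventually (\<lambda>n. \<forall>d. rate p * real d \<le> 3 * ln n \<longrightarrow>
       real n ^ 2 * (1 - p\<^sup>2) ^ d \<le> real n powr w \<longrightarrow>
       approximable p 11 (real n powr (2 - \<epsilon>)) n d (real n powr (- 1 / 2) + C * real n powr (- w))) sequentially"
    by (rule approximable_near_threshold[OF p])
  obtain C' where below: "eventually (\<lambda>n. \<forall>d s. s \<ge> 1 \<longrightarrow> rate p * real d \<le> 3 * ln n \<longrightarrow>
       real n powr w \<le> real n ^ 2 * (1 - p\<^sup>2) ^ d \<longrightarrow>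
       approximable p 1 s n d (C' * (real n powr (- w / 4) + 1 / n))) sequentially"
    by (rule approximable_below_threshold[OF p w])
  define \<delta> where "\<delta> n = max (1 / real n) (max (C' * (real n powr (- w / 4) + 1 / real n))
    (real n powr (- 1 / 2) + C * real n powr (- w)))" for n
  have powr_lim: "(\<lambda>n. real n powr a) \<longlonglongrightarrow> 0" if "a < 0" for a
    using that filterlim_real_sequentially by (rule tendsto_neg_powr)
  have inv_lim: "(\<lambda>n. 1 / real n) \<longlonglongrightarrow> 0" by real_asymp
  moreover have "(\<lambda>n. C' * (real n powr (- w / 4) + 1 / real n)) \<longlonglongrightarrow> C' * (0 + 0)"
    using w by (intro tendsto_mult_left tendsto_add powr_lim inv_lim) simp
  moreover have "(\<lambda>n. real n powr (- 1 / 2) + C * real n powr (- w)) \<longlonglongrightarrow> 0 + C * 0"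
    using w by (intro tendsto_add tendsto_mult_left powr_lim) simp_all
  ultimately have "\<delta> \<longlonglongrightarrow> max 0 (max (C' * (0 + 0)) (0 + C * 0))"
    unfolding \<delta>_def by (intro tendsto_max)
  then have "\<delta> \<longlonglongrightarrow> 0" by simp
  moreover from near below eventually_ge_at_top[of 1]
  have "eventually (\<lambda>n. \<forall>d. approximable p 11 (real n powr (2 - \<epsilon>)) n d (\<delta> n)) sequentially"
  proof eventually_elim
    case (elim n)
    have s: "1 \<le> real n powr (2 - \<epsilon>)" using elim(3) \<epsilon> by (intro ge_one_powr_ge_zero) auto
    show ?case
    proof
      fix d
      consider "3 * ln n < rate p * real d"
        | "rate p * real d \<le> 3 * ln n" "real n powr w \<le> real n ^ 2 * (1 - p\<^sup>2) ^ d"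
        | "rate p * real d \<le> 3 * ln n" "real n ^ 2 * (1 - p\<^sup>2) ^ d \<le> real n powr w"
        by linarith
      then show "approximable p 11 (real n powr (2 - \<epsilon>)) n d (\<delta> n)"
      proof cases
        case 1
        from approximable_large_dim[OF p elim(3) 1 s] show ?thesis
          by (rule approximable_mono) (simp_all add: \<delta>_def)
      next
        case 2
        have "approximable p 1 (real n powr (2 - \<epsilon>)) n d (C' * (real n powr (- w / 4) + 1 / n))"
          by (rule elim(2)[rule_format, OF s 2])
        then show ?thesis by (rule approximable_mono) (simp_all add: \<delta>_def)
      next
        case 3
        have "approximable p 11 (real n powr (2 - \<epsilon>)) n d (real n powr (- 1 / 2) + C * real n powr (- w))"
          by (rule elim(1)[rule_format, OF 3])
        then show ?thesis by (rule approximable_mono) (simp_all add: \<delta>_def)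
      qed
    qed
  qed
  ultimately have "approximable_family p \<epsilon>" using \<epsilon> by (intro approximable_familyI)
  with \<epsilon> that show ?thesis by blast
qed

theorem theorem1p4:
  "\<exists>\<epsilon> :: real \<Rightarrow> real.
     (\<epsilon> \<longlongrightarrow> 1) (at_left 1) \<and>
     (\<forall>p \<in> {0<..<1}.
        \<epsilon> p > 0 \<and>
        (\<exists>(\<delta> :: nat \<Rightarrow> real) (D :: nat).
           \<delta> \<longlonglongrightarrow> 0 \<and>
           (\<forall>n\<ge>1. \<forall>d. \<exists>F :: (nat \<times> nat) formula.
              vars F \<subseteq> bits n d \<and>
              formula_depth F \<le> D \<and>
              real (formula_size F) \<le> real n powr (2 - \<epsilon> p) \<and>
              measure_pmf.prob (OV_dist p n d) {x. eval_formula x F \<noteq> OV n d x} \<le> \<delta> n)))"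
proof -
  \<comment> \<open>The explicit values near \<open>p = 1\<close> determine the limit; for the
    remaining \<open>p\<close> any positive admissible value serves and is picked by choice.\<close>
  define \<epsilon> where "\<epsilon> p = (if rate p \<ge> 8 then 1 - 4 / rate p else SOME e. 0 < e \<and> approximable_family p e)" for p
  have lim: "((\<lambda>p. 1 - 4 / rate p) \<longlongrightarrow> 1) (at_left 1)"
    unfolding rate_def by real_asymp
  have "filterlim rate at_top (at_left 1)"
    unfolding rate_def by real_asymp
  then have "eventually (\<lambda>p. rate p \<ge> 8) (at_left 1)"
    by (simp add: filterlim_at_top)
  then have "eventually (\<lambda>p. 1 - 4 / rate p = \<epsilon> p) (at_left 1)"
    by eventually_elim (simp add: \<epsilon>_def)
  with lim have "(\<epsilon> \<longlongrightarrow> 1) (at_left 1)" by (rule Lim_transform_eventually)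
  moreover have "0 < \<epsilon> p \<and> approximable_family p (\<epsilon> p)" if "p \<in> {0<..<1}" for p
  proof (cases "rate p \<ge> 8")
    case True
    then have "0 < 1 - 4 / rate p" by (simp add: field_simps)
    then show ?thesis using that True approximable_family_near_1[of p] by (simp add: \<epsilon>_def)
  next
    case False
    have "\<exists>e. 0 < e \<and> approximable_family p e"
      using that approximable_family_exists[of p] by (metis greaterThanLessThan_iff)
    from someI_ex[OF this] show ?thesis using False by (simp add: \<epsilon>_def)
  qed
  ultimately show ?thesis
    unfolding approximable_family_def approximable_def by blast
qed

end
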